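(* Let $\xi\in\partial\mathbb B$ and let $f$ be a slice regular function on $\mathbb B\cup[\xi]$ such that $f(\mathbb B)\subseteq\mathbb B$, $f(0)=0$ and $f(\xi)=\xi$. Then $$f'(\xi)-\big[\xi,R_{\overline{\xi}}R_{\xi}f(\xi)\big]>1$$ unless $f(q)=q$ for all $q\in\mathbb B$.
   Context: $\mathbb H$ is the algebra of quaternions, $\mathbb B=\{q\in\mathbb H:|q|<1\}$, $\mathbb S=\{q\in\mathbb H:q^2=-1\}$, and $\mathbb C_I=\mathbb R\oplus I\mathbb R$ for $I\in\mathbb S$. A function $f$ on a domain $\Omega\subseteq\mathbb H$ is slice regular if for every $I\in\mathbb S$ its restriction $f_I$ to $\Omega\cap\mathbb C_I$ has continuous partial derivatives and satisfies $\frac12\left(\frac{\partial}{\partial x}+I\frac{\partial}{\partial y}\right)f_I(x+yI)=0$. The slice derivative is $f'(x+yI)=\frac12\left(\frac{\partial}{\partial x}-I\frac{\partial}{\partial y}\right)f_I(x+yI)$. A domain $\Omega$ is an axially symmetric slice domain if it meets $\mathbb R$, $\Omega\cap\mathbb C_I$ is a domain of $\mathbb C_I$ for every $I\in\mathbb S$, and $x+yI\in\Omega$ ($x,y\in\mathbb R$, $I\in\mathbb S$) implies $x+y\mathbb S\subseteq\Omega$. $[\xi]=\{q\xi q^{-1}:q\in\mathbb H\setminus\{0\}\}$. "Slice regular on $\mathbb B\cup[\xi]$" means: slice regular on some axially symmetric slice domain containing $\mathbb B\cup[\xi]$. For quaternions $a,b$, $[a,b]=ab-ba$. For $f$ slice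 regular on an axially symmetric slice domain $\Omega$ and $\xi\in\Omega$, $R_\xi f(q):=(q-\xi)^{-\ast}\ast\big(f(q)-f(\xi)\big)$ is the unique slice regular function on $\Omega$ with $f(q)-f(\xi)=(q-\xi)\ast R_\xi f(q)$, where $\ast$ is the regular product (for power series, $\sum q^na_n\ast\sum q^nb_n=\sum q^n\sum_{k=0}^na_kb_{n-k}$); for $\xi\ne0$ and $h$ slice regular on $\Omega$, $(q-\xi)\ast h(q)=q\,h(q)-\xi\,h(\xi^{-1}q\xi)$. $R_{\overline\xi}R_\xi f(\xi)$ is the value at $\xi$ of $R_{\overline\xi}(R_\xi f)$. An inequality between a quaternion and a real number asserts that the quaternion is real and the inequality holds. *)

theory Defs
  imports "HOL-Analysis.Analysis"
begin

section \<open>The algebra of quaternions\<close>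

datatype quat = Quat (qre: real) (qi: real) (qj: real) (qk: real)

lemma quat_eqI:
  "qre p = qre q \<Longrightarrow> qi p = qi q \<Longrightarrow> qj p = qj q \<Longrightarrow> qk p = qk q \<Longrightarrow> p = q"
  by (rule quat.expand) auto

lemma quat_eq_iff:
  "p = q \<longleftrightarrow> qre p = qre q \<and> qi p = qi q \<and> qj p = qj q \<and> qk p = qk q"
  by (auto intro: quat_eqI)

instantiation quat :: "{zero, one, plus, minus, uminus, times, scaleR}"
begin

definition "0 = Quat 0 0 0 0"
definition "1 = Quat 1 0 0 0"
definition "p + q = Quat (qre p + qre q) (qi p + qi q) (qj p + qj q) (qk p + qk q)"
definition "p - q = Quat (qre p - qre q) (qi p - qi q) (qj p - qj q) (qk p - qk q)"
definition "- q = Quat (- qre q) (- qi q) (- qj q) (- qk q)"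
definition "scaleR r q = Quat (r * qre q) (r * qi q) (r * qj q) (r * qk q)"
definition "p * q = Quat
  (qre p * qre q - qi p * qi q - qj p * qj q - qk p * qk q)
  (qre p * qi q + qi p * qre q + qj p * qk q - qk p * qj q)
  (qre p * qj q - qi p * qk q + qj p * qre q + qk p * qi q)
  (qre p * qk q + qi p * qj q - qj p * qi q + qk p * qre q)"

instance ..

end

lemma quat_sel [simp]:
  "qre 0 = 0" "qi 0 = 0" "qj 0 = 0" "qk 0 = 0"
  "qre 1 = 1" "qi 1 = 0" "qj 1 = 0" "qk 1 = 0"
  "qre (p + q) = qre p + qre q" "qi (p + q) = qi p + qi q"
  "qj (p + q) = qj p + qj q" "qk (p + q) = qk p + qk q"
  "qre (p - q) = qre p - qre q" "qi (p - q) = qi p - qi q"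
  "qj (p - q) = qj p - qj q" "qk (p - q) = qk p - qk q"
  "qre (- q) = - qre q" "qi (- q) = - qi q" "qj (- q) = - qj q" "qk (- q) = - qk q"
  "qre (r *\<^sub>R q) = r * qre q" "qi (r *\<^sub>R q) = r * qi q"
  "qj (r *\<^sub>R q) = r * qj q" "qk (r *\<^sub>R q) = r * qk q"
  by (simp_all add: zero_quat_def one_quat_def plus_quat_def minus_quat_def
      uminus_quat_def scaleR_quat_def)

lemma quat_sel_mult [simp]:
  "qre (p * q) = qre p * qre q - qi p * qi q - qj p * qj q - qk p * qk q"
  "qi (p * q) = qre p * qi q + qi p * qre q + qj p * qk q - qk p * qj q"
  "qj (p * q) = qre p * qj q - qi p * qk q + qj p * qre q + qk p * qi q"
  "qk (p * q) = qre p * qk q + qi p * qj q - qj p * qi q + qk p * qre q"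
  by (simp_all add: times_quat_def)

instance quat :: ring_1
  by standard (simp_all add: quat_eq_iff algebra_simps)

instance quat :: real_algebra_1
  by standard (simp_all add: quat_eq_iff algebra_simps)

instantiation quat :: real_inner
begin

definition "inner p q = qre p * qre q + qi p * qi q + qj p * qj q + qk p * qk q"
definition "norm (q :: quat) = sqrt (inner q q)"
definition "sgn (q :: quat) = q /\<^sub>R norm q"
definition "dist (p :: quat) q = norm (p - q)"
definition [code del]:
  "(uniformity :: (quat \<times> quat) filter) = (INF e\<in>{0<..}. principal {(x, y). dist x y < e})"
definition [code del]:
  "open (U :: quat set) \<longleftrightarrow> (\<forall>x\<in>U. \<forall>\<^sub>F (x', y) in uniformity. x' = x \<longrightarrow> y \<in> U)"

instance
proof
  fix p q r :: quat and a :: real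
  show "inner p q = inner q p" "inner (p + q) r = inner p r + inner q r"
    "inner (a *\<^sub>R p) q = a * inner p q" "0 \<le> inner p p"
    by (simp_all add: inner_quat_def algebra_simps)
  show "inner p p = 0 \<longleftrightarrow> p = 0"
    by (simp add: inner_quat_def quat_eq_iff add_nonneg_eq_0_iff)
qed (fact norm_quat_def sgn_quat_def dist_quat_def uniformity_quat_def open_quat_def)+

end

definition qcnj :: "quat \<Rightarrow> quat" where
  "qcnj q = Quat (qre q) (- qi q) (- qj q) (- qk q)"

lemma qcnj_sel [simp]:
  "qre (qcnj q) = qre q" "qi (qcnj q) = - qi q" "qj (qcnj q) = - qj q" "qk (qcnj q) = - qk q"
  by (simp_all add: qcnj_def)

lemma norm_quat_power2: "(norm q)\<^sup>2 = (qre q)\<^sup>2 + (qi q)\<^sup>2 + (qj q)\<^sup>2 + (qk q)\<^sup>2"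
  unfolding power2_norm_eq_inner inner_quat_def by (simp add: power2_eq_square)

lemma qcnj_mult_self: "qcnj q * q = of_real ((norm q)\<^sup>2)" "q * qcnj q = of_real ((norm q)\<^sup>2)"
  unfolding norm_quat_power2 by (simp_all add: quat_eq_iff of_real_def power2_eq_square)

instantiation quat :: real_normed_div_algebra
begin

definition "inverse q = qcnj q /\<^sub>R (norm q)\<^sup>2"
definition "(p :: quat) div q = p * inverse q"

instance
proof
  fix p q :: quat
  show "p \<noteq> 0 \<Longrightarrow> inverse p * p = 1" "p \<noteq> 0 \<Longrightarrow> p * inverse p = 1"
    by (simp_all add: inverse_quat_def qcnj_mult_self del: of_real_power)
      (simp_all add: of_real_def)
  show "p div q = p * inverse q" by (fact divide_quat_def)
  show "inverse (0 :: quat) = 0"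
    by (simp add: inverse_quat_def)
  have "(norm (p * q))\<^sup>2 = (norm p * norm q)\<^sup>2"
    unfolding power_mult_distrib norm_quat_power2 quat_sel_mult by algebra
  then show "norm (p * q) = norm p * norm q"
    by simp
qed

end


section \<open>Slice regular functions\<close>

definition imag_units :: "quat set" where
  "imag_units = {q. q\<^sup>2 = -1}"

definition slice_point :: "quat \<Rightarrow> real \<Rightarrow> real \<Rightarrow> quat" where
  "slice_point I x y = of_real x + of_real y * I"

definition slice_plane :: "quat \<Rightarrow> quat set" where
  "slice_plane I = {slice_point I x y | x y. True}"

definition domain_in :: "quat set \<Rightarrow> quat set \<Rightarrow> bool" where
  "domain_in X U \<longleftrightarrow> openin (top_of_set X) U \<and> connected U \<and> U \<noteq> {}"

definition axially_symmetric_slice_domain :: "quat set \<Rightarrow> bool" where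
  "axially_symmetric_slice_domain \<Omega> \<longleftrightarrow>
     domain_in UNIV \<Omega> \<and>
     \<Omega> \<inter> \<real> \<noteq> {} \<and>
     (\<forall>I\<in>imag_units. domain_in (slice_plane I) (\<Omega> \<inter> slice_plane I)) \<and>
     (\<forall>I\<in>imag_units. \<forall>x y. slice_point I x y \<in> \<Omega> \<longrightarrow>
        (\<forall>J\<in>imag_units. slice_point J x y \<in> \<Omega>))"

definition slice_dx :: "(quat \<Rightarrow> quat) \<Rightarrow> quat \<Rightarrow> real \<Rightarrow> real \<Rightarrow> quat" where
  "slice_dx f I x y = vector_derivative (\<lambda>t. f (slice_point I t y)) (at x)"

definition slice_dy :: "(quat \<Rightarrow> quat) \<Rightarrow> quat \<Rightarrow> real \<Rightarrow> real \<Rightarrow> quat" where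
  "slice_dy f I x y = vector_derivative (\<lambda>t. f (slice_point I x t)) (at y)"

definition slice_regular_on :: "quat set \<Rightarrow> (quat \<Rightarrow> quat) \<Rightarrow> bool" where
  "slice_regular_on \<Omega> f \<longleftrightarrow>
     (\<forall>I\<in>imag_units.
        (\<forall>x y. slice_point I x y \<in> \<Omega> \<longrightarrow>
           (\<lambda>t. f (slice_point I t y)) differentiable (at x) \<and>
           (\<lambda>t. f (slice_point I x t)) differentiable (at y)) \<and>
        continuous_on {(x, y). slice_point I x y \<in> \<Omega>} (\<lambda>(x, y). slice_dx f I x y) \<and>
        continuous_on {(x, y). slice_point I x y \<in> \<Omega>} (\<lambda>(x, y). slice_dy f I x y) \<and>
        (\<forall>x y. slice_point I x y \<in> \<Omega> \<longrightarrow>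
           (1/2) *\<^sub>R (slice_dx f I x y + I * slice_dy f I x y) = 0))"

text \<open>A quaternion has several representations \<open>x + y I\<close> (two off the real axis, infinitely many
  on it); \<open>slice_deriv_slice_point\<close> below shows that for slice regular functions all of them
  give the same value.\<close>

definition slice_deriv :: "(quat \<Rightarrow> quat) \<Rightarrow> quat \<Rightarrow> quat" where
  "slice_deriv f q =
     (THE d. \<forall>I\<in>imag_units. \<forall>x y. q = slice_point I x y \<longrightarrow>
        d = (1/2) *\<^sub>R (slice_dx f I x y - I * slice_dy f I x y))"

lemma imag_units_iff: "I \<in> imag_units \<longleftrightarrow> qre I = 0 \<and> (qi I)\<^sup>2 + (qj I)\<^sup>2 + (qk I)\<^sup>2 = 1"
proof
  assume "I \<in> imag_units"
  then have e: "qre I * qre I - qi I * qi I - qj I * qj I - qk I * qk I = -1"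
    "qre I * qi I = 0" "qre I * qj I = 0" "qre I * qk I = 0"
    by (auto simp: imag_units_def power2_eq_square quat_eq_iff)
  have "qre I = 0"
  proof (rule ccontr)
    assume "qre I \<noteq> 0"
    with e have "qre I * qre I = -1" by simp
    moreover have "0 \<le> qre I * qre I" by simp
    ultimately show False by linarith
  qed
  with e show "qre I = 0 \<and> (qi I)\<^sup>2 + (qj I)\<^sup>2 + (qk I)\<^sup>2 = 1"
    by (simp add: power2_eq_square)
next
  assume "qre I = 0 \<and> (qi I)\<^sup>2 + (qj I)\<^sup>2 + (qk I)\<^sup>2 = 1"
  then show "I \<in> imag_units"
    by (simp add: imag_units_def power2_eq_square quat_eq_iff)
qed

lemma slice_point_sel [simp]:
  "qre (slice_point I x y) = x + y * qre I" "qi (slice_point I x y) = y * qi I"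
  "qj (slice_point I x y) = y * qj I" "qk (slice_point I x y) = y * qk I"
  by (simp_all add: slice_point_def of_real_def)

lemma slice_point_eqD:
  assumes "I \<in> imag_units" "J \<in> imag_units" "slice_point I x y = slice_point J u v"
  shows "x = u \<and> (y = 0 \<and> v = 0 \<or> y = v \<and> I = J \<or> y = - v \<and> I = - J)"
proof -
  have I: "qre I = 0" "(qi I)\<^sup>2 + (qj I)\<^sup>2 + (qk I)\<^sup>2 = 1"
    and J: "qre J = 0" "(qi J)\<^sup>2 + (qj J)\<^sup>2 + (qk J)\<^sup>2 = 1"
    using assms by (auto simp: imag_units_iff)
  have e: "x = u" "y * qi I = v * qi J" "y * qj I = v * qj J" "y * qk I = v * qk J"
    using assms(3) I J by (auto simp: quat_eq_iff)
  have "y\<^sup>2 = y\<^sup>2 * ((qi I)\<^sup>2 + (qj I)\<^sup>2 + (qk I)\<^sup>2)" using I by simp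
  also have "\<dots> = (y * qi I)\<^sup>2 + (y * qj I)\<^sup>2 + (y * qk I)\<^sup>2"
    by (simp add: algebra_simps power_mult_distrib)
  also have "\<dots> = v\<^sup>2 * ((qi J)\<^sup>2 + (qj J)\<^sup>2 + (qk J)\<^sup>2)"
    unfolding e by (simp add: algebra_simps power_mult_distrib)
  also have "\<dots> = v\<^sup>2" using J by simp
  finally have "y = v \<or> y = - v" by (simp add: power2_eq_iff)
  then show ?thesis
  proof
    assume "y = v"
    then show ?thesis using e I J by (cases "v = 0") (auto simp: quat_eq_iff)
  next
    assume y: "y = - v"
    show ?thesis
    proof (cases "v = 0")
      case False
      have "v * (qi I + qi J) = 0" "v * (qj I + qj J) = 0" "v * (qk I + qk J) = 0"
        using e y by (simp_all add: algebra_simps)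
      with False have "qi I + qi J = 0" "qj I + qj J = 0" "qk I + qk J = 0" by simp_all
      then have "I = - J" using I J by (simp add: quat_eq_iff)
      then show ?thesis using y e by simp
    qed (use y e in simp)
  qed
qed

lemma slice_dx_uminus: "slice_dx f (- I) x (- y) = slice_dx f I x y"
  by (simp add: slice_dx_def slice_point_def)

lemma slice_dy_uminus:
  assumes "(\<lambda>t. f (slice_point I x t)) differentiable (at y)"
  shows "slice_dy f (- I) x (- y) = - slice_dy f I x y"
proof -
  have "((\<lambda>t. f (slice_point I x t)) has_vector_derivative slice_dy f I x y) (at (- (- y)))"
    using assms by (simp add: slice_dy_def vector_derivative_works)
  then have "(((\<lambda>t. f (slice_point I x t)) \<circ> uminus)
      has_vector_derivative ((-1) *\<^sub>R slice_dy f I x y)) (at (- y))"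
    by (intro vector_diff_chain_at) (auto intro!: derivative_eq_intros)
  then show ?thesis
    by (simp add: slice_dy_def o_def slice_point_def vector_derivative_at)
qed

lemma slice_deriv_slice_point:
  assumes f: "slice_regular_on \<Omega> f" and I: "I \<in> imag_units" and x: "slice_point I x y \<in> \<Omega>"
  shows "slice_deriv f (slice_point I x y) =
    (1/2) *\<^sub>R (slice_dx f I x y - I * slice_dy f I x y)"
proof -
  have *: "(1/2) *\<^sub>R (slice_dx f J u v - J * slice_dy f J u v) =
        (1/2) *\<^sub>R (slice_dx f I x y - I * slice_dy f I x y)"
    if J: "J \<in> imag_units" and e: "slice_point I x y = slice_point J u v" for J u v
    using slice_point_eqD[OF I J e]
  proof (elim conjE disjE)
    assume 0: "x = u" "y = 0" "v = 0"
    have "slice_point K u 0 \<in> \<Omega>" for K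
      using x 0 by (simp add: slice_point_def)
    then have *: "slice_dx f K u 0 = - (K * slice_dy f K u 0)" if "K \<in> imag_units" for K
      using f that unfolding slice_regular_on_def
      by (auto simp: eq_neg_iff_add_eq_0)
    then have h: "(1/2) *\<^sub>R (slice_dx f K u 0 - K * slice_dy f K u 0) = slice_dx f K u 0"
      if "K \<in> imag_units" for K
    proof -
      have "slice_dx f K u 0 - K * slice_dy f K u 0 = 2 *\<^sub>R slice_dx f K u 0"
        using *[OF that] by (simp add: scaleR_2)
      then show ?thesis by simp
    qed
    have "slice_dx f I u 0 = slice_dx f J u 0"
      by (simp add: slice_dx_def slice_point_def)
    with h I J 0 show ?thesis by metis
  next
    assume "x = u" "y = v" "I = J"
    then show ?thesis by simp
  next
    assume a: "x = u" "y = - v" "I = - J"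
    have "(\<lambda>t. f (slice_point I x t)) differentiable (at y)"
      using f I x by (auto simp: slice_regular_on_def)
    from slice_dy_uminus[OF this] slice_dx_uminus[of f I x y] a show ?thesis
      by simp
  qed
  show ?thesis
    unfolding slice_deriv_def
  proof (rule the_equality, intro ballI allI impI)
    fix J u v
    assume "J \<in> imag_units" "slice_point I x y = slice_point J u v"
    then show "(1/2) *\<^sub>R (slice_dx f I x y - I * slice_dy f I x y) =
        (1/2) *\<^sub>R (slice_dx f J u v - J * slice_dy f J u v)"
      by (rule *[symmetric])
  qed (use I in blast)
qed

definition conj_class :: "quat \<Rightarrow> quat set" where
  "conj_class \<xi> = {q * \<xi> * inverse q | q. q \<noteq> 0}"

definition commutator :: "quat \<Rightarrow> quat \<Rightarrow> quat" where
  "commutator a b = a * b - b * a"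


section \<open>The operator $R_\xi$\<close>

text \<open>The value at \<open>q\<close> of the regular product of the polynomial \<open>q - \<xi>\<close> with \<open>h\<close>.  The formula
  also covers \<open>\<xi> = 0\<close>, where the second summand vanishes; \<open>linear_star_power_series\<close> recovers the
  Cauchy product of the coefficients.\<close>

definition linear_star :: "quat \<Rightarrow> (quat \<Rightarrow> quat) \<Rightarrow> quat \<Rightarrow> quat" where
  "linear_star \<xi> h q = q * h q - \<xi> * h (inverse \<xi> * q * \<xi>)"

lemma linear_star_power_series:
  fixes a b :: "nat \<Rightarrow> quat"
  assumes a: "a = (\<lambda>n. if n = 0 then - \<xi> else if n = 1 then 1 else 0)"
    and h: "\<And>q. norm q < r \<Longrightarrow> (\<lambda>n. q ^ n * b n) sums h q"
    and q: "norm q < r"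
  shows "(\<lambda>n. q ^ n * (\<Sum>k\<le>n. a k * b (n - k))) sums linear_star \<xi> h q"
proof -
  have pow: "\<xi> * ((inverse \<xi> * q * \<xi>) ^ n * c) = q ^ n * \<xi> * c" for n c
  proof (cases "\<xi> = 0")
    case False
    then have "\<xi> * (inverse \<xi> * u) = u" for u
      by (simp flip: mult.assoc)
    then have "(inverse \<xi> * q * \<xi>) ^ n = inverse \<xi> * q ^ n * \<xi>"
      by (induction n) (use False in \<open>simp_all add: mult.assoc\<close>)
    then show ?thesis
      using False by (simp add: mult.assoc[symmetric])
  qed simp
  have s: "(\<lambda>n. q ^ n * \<xi> * b n) sums (\<xi> * h (inverse \<xi> * q * \<xi>))"
  proof (cases "\<xi> = 0")
    case False
    then have "inverse (norm \<xi>) * norm q * norm \<xi> = norm q"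
      by (simp add: mult.commute[of _ "norm q"] mult.assoc)
    then have "norm (inverse \<xi> * q * \<xi>) < r"
      using q by (simp only: norm_mult norm_inverse)
    from sums_mult[OF h[OF this], of \<xi>] show ?thesis
      by (simp add: pow)
  qed simp
  have "(\<lambda>n. if Suc n = 0 then 0 else q ^ Suc n * b (Suc n - 1)) sums (q * h q)"
    using sums_mult[OF h[OF q], of q] by (simp add: mult.assoc)
  then have t: "(\<lambda>n. if n = 0 then 0 else q ^ n * b (n - 1)) sums (q * h q)"
    by (subst (asm) sums_Suc_iff) simp
  have c: "(\<Sum>k\<le>n. a k * b (n - k)) = (if n = 0 then 0 else b (n - 1)) - \<xi> * b n" for n
  proof (cases n)
    case (Suc m)
    have "(\<Sum>k\<le>n. a k * b (n - k)) = (\<Sum>k\<in>{0, 1}. a k * b (n - k))"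
      by (rule sum.mono_neutral_right) (auto simp: a Suc)
    then show ?thesis by (simp add: a Suc)
  qed (simp add: a)
  have "(\<lambda>n. q ^ n * (\<Sum>k\<le>n. a k * b (n - k))) =
      (\<lambda>n. (if n = 0 then 0 else q ^ n * b (n - 1)) - q ^ n * \<xi> * b n)"
    by (rule ext) (simp add: c right_diff_distrib mult.assoc)
  with sums_diff[OF t s] show ?thesis
    by (simp add: linear_star_def)
qed

text \<open>Functions are total, so the values outside \<open>\<Omega>\<close> are fixed to \<open>0\<close> to make \<open>R\<^sub>\<xi> f\<close> unique.\<close>

definition regular_quotient :: "quat set \<Rightarrow> quat \<Rightarrow> (quat \<Rightarrow> quat) \<Rightarrow> quat \<Rightarrow> quat" where
  "regular_quotient \<Omega> \<xi> f =
     (THE g. slice_regular_on \<Omega> g \<and>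
        (\<forall>q\<in>\<Omega>. f q - f \<xi> = linear_star \<xi> g q) \<and>
        (\<forall>q. q \<notin> \<Omega> \<longrightarrow> g q = 0))"

end

theory Submission
  imports Defs "HOL-Complex_Analysis.Complex_Analysis"
begin

text \<open>
  Let \<open>I\<close> be an imaginary unit whose slice contains \<open>\<xi>\<close>. Restricted to
  that slice, slice regular functions are quaternion-valued functions that are holomorphic for left
  multiplication by \<open>I\<close>, and by the representation formula
  (\<open>representation_formula\<close>) the restriction determines the function. The regular
  product with \<open>q - \<xi>\<close> is the pointwise product on the slice of
  \<open>\<xi>\<close>, so on it \<open>R\<^sub>\<xi> f\<close> is the usual difference quotient
  \<open>(z - \<xi>)\<^sup>-\<^sup>1 (f z - f \<xi>)\<close>, with value \<open>f' \<xi>\<close> at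
  \<open>\<xi>\<close> (\<open>regular_quotient_props\<close>).

  For \<open>\<xi>\<close> not real this gives \<open>R\<^bsub>qcnj \<xi>\<^esub> (R\<^sub>\<xi> f)
  \<xi> = (\<xi> - qcnj \<xi>)\<^sup>-\<^sup>1 (f' \<xi> - R\<^sub>\<xi> f (qcnj \<xi>))\<close>.
  The commutator of this with \<open>\<xi>\<close> is the part of \<open>f' \<xi> - R\<^sub>\<xi> f
  (qcnj \<xi>)\<close> orthogonal to the slice. Now \<open>f (qcnj \<xi>)\<close>, and with it
  \<open>R\<^sub>\<xi> f (qcnj \<xi>)\<close>, lies in the slice: on the sphere of
  \<open>\<xi>\<close>, \<open>f\<close> is an affine function of the imaginary unit, of modulus at
  most \<open>1\<close>, and it attains modulus \<open>1\<close> at \<open>I\<close>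
  (\<open>boundary_value_at_conjugate\<close>). Hence \<open>f' \<xi> - [\<xi>, R\<^bsub>qcnj
  \<xi>\<^esub> (R\<^sub>\<xi> f) \<xi>]\<close> is the component of \<open>f' \<xi>\<close> inside
  the slice (\<open>second_quotient_commutator\<close>).

  This component is the derivative at \<open>\<xi>\<close> of \<open>F\<close>, the component of
  \<open>f\<close> inside the slice, which is a holomorphic self-map of the unit disc fixing
  \<open>0\<close> and \<open>\<xi>\<close>. By the boundary Schwarz lemma its derivative there is
  real and exceeds \<open>1\<close>, unless \<open>F\<close> is the identity
  (\<open>boundary_Schwarz\<close>). In that case \<open>|f| < 1\<close> and the maximum principle
  make the orthogonal component of \<open>f\<close> vanish, and \<open>f\<close> is the identity
  (\<open>identity_if_slice_component_identity\<close>).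

  A real \<open>\<xi>\<close> commutes with everything and lies in every slice. The commutator is
  then zero, and \<open>f' \<xi>\<close> is real because its component in each slice is.
\<close>

section \<open>The boundary Schwarz lemma\<close>

text \<open>The pseudo-hyperbolic disc of radius \<open>r\<close> about \<open>a\<close> reaches
  furthest from the origin on the ray through \<open>a\<close>, at modulus \<open>(|a| + r) / (1 +
  |a| r)\<close>.\<close>

lemma norm_le_of_moebius_bound:
  fixes w a :: complex
  assumes w: "norm w \<le> 1" and a: "norm a < 1" and r: "0 \<le> r" "r < 1"
    and le: "norm (w - a) \<le> r * norm (1 - cnj a * w)"
  shows "norm w \<le> (norm a + r) / (1 + norm a * r)"
proof -
  define s t u where "s = norm w" and "t = norm a" and "u = Re (cnj a * w)"
  have st: "s * t \<le> 1" "0 \<le> s" "0 \<le> t"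
    using w a unfolding s_def t_def by (auto intro!: mult_le_one)
  have u: "u \<le> s * t"
    using complex_Re_le_cmod[of "cnj a * w"] by (simp add: u_def s_def t_def norm_mult mult.commute)
  have n1: "(norm (w - a))\<^sup>2 = s\<^sup>2 + t\<^sup>2 - 2 * u"
    unfolding s_def t_def u_def cmod_power2 by (simp add: power2_eq_square algebra_simps)
  have n2: "(norm (1 - cnj a * w))\<^sup>2 = 1 + s\<^sup>2 * t\<^sup>2 - 2 * u"
    unfolding s_def t_def u_def cmod_power2 by (simp add: power2_eq_square algebra_simps)
  have "(norm (w - a))\<^sup>2 \<le> (r * norm (1 - cnj a * w))\<^sup>2"
    using le by (intro power_mono) auto
  then have *: "s\<^sup>2 + t\<^sup>2 - 2 * u \<le> r\<^sup>2 * (1 + s\<^sup>2 * t\<^sup>2 - 2 * u)"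
    by (simp add: n1 n2 power_mult_distrib)
  have "r\<^sup>2 \<le> 1" using r by (simp add: power_le_one)
  then have "(1 - r\<^sup>2) * u \<le> (1 - r\<^sup>2) * (s * t)"
    using u by (intro mult_left_mono) auto
  with * have "(s - t)\<^sup>2 \<le> (r * (1 - s * t))\<^sup>2"
    by (simp add: power2_eq_square algebra_simps)
  then have "s - t \<le> r * (1 - s * t)"
    by (rule power2_le_imp_le) (use r st in auto)
  then have "s * (1 + t * r) \<le> t + r"
    by (simp add: algebra_simps)
  moreover have "0 < 1 + t * r"
    using r st by (simp add: add_pos_nonneg)
  ultimately show ?thesis
    by (simp add: pos_le_divide_eq s_def t_def)
qed

text \<open>Schwarz--Pick at the origin, applied to \<open>h z = F z / z\<close>: composing
  \<open>h\<close> with the Moebius map that sends \<open>h 0 = F' 0\<close> to \<open>0\<close>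
  gives a self-map of the disc fixing \<open>0\<close>, so that \<open>h z\<close> stays within
  pseudo-hyperbolic distance \<open>|z|\<close> of \<open>F' 0\<close>.\<close>

lemma refined_Schwarz:
  assumes hol: "F holomorphic_on ball 0 1" and F0: "F 0 = 0"
    and less: "\<And>z. norm z < 1 \<Longrightarrow> norm (F z) < 1"
    and z: "norm z < 1" and rot: "norm (deriv F 0) < 1"
  shows "norm (F z) \<le> norm z * ((norm (deriv F 0) + norm z) / (1 + norm (deriv F 0) * norm z))"
proof -
  obtain h where h: "h holomorphic_on ball 0 1"
    and Fh: "\<And>z. norm z < 1 \<Longrightarrow> F z = z * h z" and h0: "deriv F 0 = h 0"
    by (rule Schwarz3[OF hol F0]) auto
  define a where "a = h 0"
  have a: "norm a < 1" using rot by (simp add: a_def h0)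
  have h1: "norm (h z) < 1" if z: "norm z < 1" for z
  proof (cases "z = 0")
    case False
    have "norm (F z) \<noteq> norm z"
    proof
      assume "norm (F z) = norm z"
      then obtain \<alpha> where al: "\<forall>z. norm z < 1 \<longrightarrow> F z = \<alpha> * z" "norm \<alpha> = 1"
        using Schwarz_Lemma(3)[OF hol F0 less z] False z by blast
      have "((\<lambda>z. \<alpha> * z) has_field_derivative \<alpha>) (at 0)"
        by (auto intro!: derivative_eq_intros)
      then have "(F has_field_derivative \<alpha>) (at 0)"
        by (rule has_field_derivative_transform_within_open[where S = "ball 0 1"]) (use al in auto)
      with al rot show False by (simp add: DERIV_imp_deriv)
    qed
    then have "norm (F z) < norm z"
      using Schwarz_Lemma(1)[OF hol F0 less z] by simp
    then show ?thesis
      using False by (simp add: Fh[OF z] norm_mult)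
  qed (use a in \<open>simp add: a_def\<close>)
  define M where "M = Moebius_function 0 a \<circ> h"
  have "M holomorphic_on ball 0 1"
    unfolding M_def
    by (rule holomorphic_on_compose_gen[OF h Moebius_function_holomorphic[OF a]]) (use h1 in auto)
  moreover have "M 0 = 0"
    by (simp add: M_def a_def Moebius_function_eq_zero)
  moreover have "norm (M z) < 1" if "norm z < 1" for z
    using Moebius_function_norm_lt_1[OF a h1[OF that]] by (simp add: M_def)
  ultimately have "norm (M z) \<le> norm z"
    using Schwarz_Lemma(1)[OF _ _ _ z] by blast
  moreover have "M z = (h z - a) / (1 - cnj a * h z)"
    by (simp add: M_def Moebius_function_simple)
  moreover have "norm (cnj a * h z) < 1"
    using a h1[OF z] by (simp add: norm_mult) (metis mult_strict_mono mult_1 norm_ge_zero zero_less_one)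
  then have "1 - cnj a * h z \<noteq> 0" by auto
  ultimately have "norm (h z - a) \<le> norm z * norm (1 - cnj a * h z)"
    by (simp add: norm_divide pos_divide_le_eq)
  then have "norm (h z) \<le> (norm a + norm z) / (1 + norm a * norm z)"
    using h1[OF z] a z by (intro norm_le_of_moebius_bound) auto
  then show ?thesis
    unfolding h0 a_def[symmetric] by (simp only: Fh[OF z] norm_mult) (intro mult_left_mono norm_ge_zero)
qed

lemma Re_mult_nonpos_imp_real:
  assumes "\<And>v. Re v < 0 \<Longrightarrow> Re (c * v) \<le> 0"
  shows "Im c = 0 \<and> 0 \<le> Re c"
proof -
  have "Re c \<ge> 0" using assms[of "-1"] by simp
  moreover have "Im c = 0"
  proof (rule ccontr)
    assume "Im c \<noteq> 0"
    \<comment> \<open>The second coordinate is chosen to give \<open>Re (c * v) = 1\<close>.\<close>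
    show False
      using assms[of "Complex (-1) (- (Re c + 1) / Im c)"] \<open>Im c \<noteq> 0\<close> by (simp add: field_simps)
  qed
  ultimately show ?thesis by simp
qed

text \<open>Every direction \<open>v\<close> with \<open>Re v < 0\<close> points from
  \<open>1\<close> into the disc, and along it \<open>Re F\<close> cannot exceed its value
  \<open>1\<close> at the boundary point. Hence multiplication by the derivative maps the left
  half-plane into its closure, which forces the derivative to be real and nonnegative.\<close>

lemma derivative_self_map_at_fixed_one:
  assumes der: "(F has_field_derivative c) (at 1)" and F1: "F 1 = 1"
    and le: "\<And>z. norm z < 1 \<Longrightarrow> norm (F z) \<le> 1"
  shows "Im c = 0 \<and> 0 \<le> Re c"
proof (rule Re_mult_nonpos_imp_real)
  fix v :: complex
  assume v: "Re v < 0"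
  define g where "g t = Re (F (1 + of_real t * v))" for t :: real
  have "((\<lambda>t. F (1 + of_real t * v)) has_vector_derivative (v * c)) (at 0)"
    by (rule field_vector_diff_chain_at[where f = "\<lambda>t. 1 + of_real t * v" and g = F and x = 0, unfolded o_def])
      (use der in \<open>auto intro!: derivative_eq_intros\<close>)
  then have "(g has_vector_derivative Re (v * c)) (at 0)"
    unfolding g_def by (rule bounded_linear.has_vector_derivative[OF bounded_linear_Re])
  then have g: "(g has_real_derivative Re (v * c)) (at 0)"
    by (simp add: has_real_derivative_iff_has_vector_derivative)
  show "Re (c * v) \<le> 0"
  proof (rule ccontr)
    assume "\<not> Re (c * v) \<le> 0"
    then obtain d where d: "d > 0" "\<And>h. 0 < h \<Longrightarrow> h < d \<Longrightarrow> g 0 < g (0 + h)"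
      using DERIV_pos_inc_right[OF g] by (auto simp: mult.commute)
    define n where "n = (Re v)\<^sup>2 + (Im v)\<^sup>2"
    have n: "n > 0" using v by (simp add: n_def add_pos_nonneg)
    \<comment> \<open>Small enough for \<open>1 + t v\<close> to lie in the disc: \<open>|1 + t v|\<^sup>2 = 1 + t (2 Re v + t |v|\<^sup>2)\<close>.\<close>
    define t where "t = min (d / 2) (- Re v / n)"
    have t: "0 < t" "t < d" using d n v by (auto simp: t_def divide_neg_pos)
    have "t * n \<le> - Re v"
      using n by (simp add: t_def min_def field_simps)
    then have "t * (2 * Re v + t * n) < 0"
      using t v by (intro mult_pos_neg) auto
    moreover have "(norm (1 + of_real t * v))\<^sup>2 = 1 + t * (2 * Re v + t * n)"
      unfolding cmod_power2 n_def by (simp add: power2_eq_square algebra_simps)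
    ultimately have "norm (1 + of_real t * v) < 1"
      by (smt (verit) norm_ge_zero one_le_power)
    then have "norm (F (1 + of_real t * v)) \<le> 1" by (rule le)
    then have "g t \<le> 1" unfolding g_def using complex_Re_le_cmod order_trans by blast
    with d(2)[OF t] F1 show False by (simp add: g_def)
  qed
qed

text \<open>If \<open>|F' 0| = 1\<close>, then \<open>F\<close> is a rotation, and continuity at
  \<open>1\<close> makes it the identity. Otherwise, with \<open>a = |F' 0| < 1\<close>, the refined
  Schwarz inequality along the radius to \<open>1\<close> bounds the difference quotient below by
  \<open>(1 + r) / (1 + a r)\<close>, so that the derivative has modulus at least \<open>2 / (1 + a)
  > 1\<close>; being real and nonnegative, it equals its modulus.\<close>

lemma boundary_Schwarz_at_one:
  assumes hol: "F holomorphic_on ball 0 1" and F0: "F 0 = 0"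
    and less: "\<And>z. norm z < 1 \<Longrightarrow> norm (F z) < 1"
    and der: "(F has_field_derivative c) (at 1)" and F1: "F 1 = 1"
    and nid: "\<not> (\<forall>z. norm z < 1 \<longrightarrow> F z = z)"
  shows "Im c = 0 \<and> 1 < Re c"
proof -
  have real: "Im c = 0 \<and> 0 \<le> Re c"
    using derivative_self_map_at_fixed_one[OF der F1] less by fastforce
  have lim: "((\<lambda>r. F (of_real r)) \<longlongrightarrow> 1) (at_left (1::real))"
  proof -
    have "isCont F (of_real 1)" using der DERIV_isCont by auto
    then have "isCont (\<lambda>r::real. F (of_real r)) 1"
      by (intro isCont_o2[where g = F and f = of_real]) auto
    then have "((\<lambda>r::real. F (of_real r)) \<longlongrightarrow> F (of_real 1)) (at_left 1)"
      using filterlim_at_split isCont_def by blast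
    then show ?thesis by (simp add: F1)
  qed
  define a where "a = norm (deriv F 0)"
  have "norm (deriv F 0) \<le> 1"
    using Schwarz_Lemma(2)[OF hol F0 less, of 0] by simp
  moreover have "norm (deriv F 0) \<noteq> 1"
  proof
    assume "norm (deriv F 0) = 1"
    then obtain \<alpha> where al: "\<forall>z. norm z < 1 \<longrightarrow> F z = \<alpha> * z" "norm \<alpha> = 1"
      using Schwarz_Lemma(3)[OF hol F0 less, of 0] by auto
    have "\<forall>\<^sub>F r in at_left (1::real). \<alpha> * of_real r = F (of_real r)"
      using eventually_at_left_real[OF zero_less_one] by (rule eventually_mono) (use al in auto)
    moreover have "((\<lambda>r. \<alpha> * of_real r) \<longlongrightarrow> \<alpha> * of_real 1) (at_left (1::real))"
      by (intro tendsto_intros)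
    ultimately have "((\<lambda>r. F (of_real r)) \<longlongrightarrow> \<alpha> * of_real 1) (at_left (1::real))"
      by (rule Lim_transform_eventually[rotated])
    with lim have "\<alpha> = 1"
      using tendsto_unique[OF trivial_limit_at_left_real] by fastforce
    with al nid show False by simp
  qed
  ultimately have a: "0 \<le> a" "a < 1" by (auto simp: a_def)
  have dq: "((\<lambda>z. norm ((F z - F 1) / (z - 1))) \<longlongrightarrow> norm c) (at 1)"
    using der by (intro tendsto_norm) (simp add: has_field_derivative_iff)
  have "filterlim (\<lambda>r. complex_of_real r) (at 1) (at_left (1::real))"
    unfolding filterlim_at
  proof
    show "(complex_of_real \<longlongrightarrow> 1) (at_left 1)"
      by (intro tendsto_eq_intros) auto
    show "\<forall>\<^sub>F x in at_left (1::real). complex_of_real x \<in> UNIV \<and> complex_of_real x \<noteq> 1"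
      using eventually_at_left_real[OF zero_less_one] by (rule eventually_mono) auto
  qed
  from filterlim_compose[OF dq this]
  have l1: "((\<lambda>r. norm ((F (of_real r) - F 1) / (of_real r - 1))) \<longlongrightarrow> norm c) (at_left (1::real))" .
  have l2: "((\<lambda>r. (1 + r) / (1 + a * r)) \<longlongrightarrow> (1 + 1) / (1 + a * 1)) (at_left (1::real))"
    using a by (intro tendsto_intros) auto
  have ev: "\<forall>\<^sub>F r in at_left (1::real). (1 + r) / (1 + a * r) \<le> norm ((F (of_real r) - F 1) / (of_real r - 1))"
    using eventually_at_left_real[OF zero_less_one]
  proof (rule eventually_mono)
    fix r :: real
    assume r: "r \<in> {0<..<1}"
    have p: "0 < 1 + a * r" using r a by (simp add: add_pos_nonneg)
    have "norm (F (of_real r)) \<le> r * ((a + r) / (1 + a * r))"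
      using refined_Schwarz[OF hol F0 less, of "of_real r"] r a by (simp add: a_def)
    moreover have "1 - r * ((a + r) / (1 + a * r)) = (1 - r) * ((1 + r) / (1 + a * r))"
      using p by (simp add: field_simps)
    moreover have "1 - norm (F (of_real r)) \<le> norm (F (of_real r) - F 1)"
      unfolding F1 using norm_triangle_ineq2[of 1 "F (of_real r)"] by (simp add: norm_minus_commute)
    ultimately have "(1 - r) * ((1 + r) / (1 + a * r)) \<le> norm (F (of_real r) - F 1)"
      by linarith
    moreover have "norm (of_real r - 1 :: complex) = 1 - r"
      using r by (metis abs_of_neg diff_less_0_iff_less greaterThanLessThan_iff minus_diff_eq norm_of_real of_real_1 of_real_diff)
    ultimately show "(1 + r) / (1 + a * r) \<le> norm ((F (of_real r) - F 1) / (of_real r - 1))"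
      using r unfolding norm_divide by (simp add: pos_le_divide_eq mult.commute)
  qed
  have "(1 + 1) / (1 + a * 1) \<le> norm c"
    by (rule tendsto_le[OF _ l1 l2 ev]) simp
  moreover have "1 < (1 + 1) / (1 + a * 1)" using a by simp
  ultimately have "1 < norm c" by simp
  moreover have "norm c = Re c"
    using real by (simp add: cmod_def)
  ultimately show ?thesis using real by simp
qed

lemma boundary_Schwarz:
  assumes hol: "F holomorphic_on ball 0 1" and F0: "F 0 = 0"
    and less: "\<And>z. norm z < 1 \<Longrightarrow> norm (F z) < 1"
    and \<zeta>: "norm \<zeta> = 1" and der: "(F has_field_derivative c) (at \<zeta>)" and fixed: "F \<zeta> = \<zeta>"
    and nid: "\<not> (\<forall>z. norm z < 1 \<longrightarrow> F z = z)"
  shows "Im c = 0 \<and> 1 < Re c"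
proof -
  define E where "E z = cnj \<zeta> * F (\<zeta> * z)" for z
  have cz: "cnj \<zeta> * \<zeta> = 1"
    using \<zeta> complex_norm_square[of \<zeta>] by (simp add: mult.commute)
  have c': "cnj \<zeta> * (c * \<zeta>) = c"
    using cz by (simp add: mult.left_commute)
  show ?thesis
  proof (rule boundary_Schwarz_at_one[of E])
    have "(F \<circ> (\<lambda>z. \<zeta> * z)) holomorphic_on ball 0 1"
      by (rule holomorphic_on_compose_gen[OF _ hol])
        (auto intro!: holomorphic_intros simp: norm_mult \<zeta>)
    then show "E holomorphic_on ball 0 1"
      unfolding E_def o_def by (intro holomorphic_intros)
    show "E 0 = 0" by (simp add: E_def F0)
    show "norm (E z) < 1" if "norm z < 1" for z
      using less[of "\<zeta> * z"] that by (simp add: E_def norm_mult \<zeta>)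
    have "(F has_field_derivative c) (at (\<zeta> * 1))" using der by simp
    then have "((\<lambda>z. F (\<zeta> * z)) has_field_derivative (c * \<zeta>)) (at 1)"
      by (rule DERIV_chain2) (auto intro!: derivative_eq_intros)
    from DERIV_cmult[OF this, of "cnj \<zeta>"] show "(E has_field_derivative c) (at 1)"
      unfolding E_def c' .
    show "E 1 = 1" by (simp add: E_def fixed cz)
    show "\<not> (\<forall>z. norm z < 1 \<longrightarrow> E z = z)"
    proof
      assume E: "\<forall>z. norm z < 1 \<longrightarrow> E z = z"
      have "F z = z" if "norm z < 1" for z
      proof -
        have "E (cnj \<zeta> * z) = cnj \<zeta> * z"
          using E that by (simp add: norm_mult \<zeta>)
        then have "cnj \<zeta> * F z = cnj \<zeta> * z"
          using cz by (simp add: E_def mult.assoc[symmetric] mult.commute[of \<zeta>])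
        then show ?thesis using \<zeta> by auto
      qed
      with nid show False by blast
    qed
  qed
qed

text \<open>The maximum principle on the circles \<open>|z| = r\<close>, as \<open>r\<close> tends
  to \<open>1\<close>.\<close>

lemma eq_0_if_norm_square_le:
  assumes hol: "H holomorphic_on ball 0 1"
    and le: "\<And>z. norm z < 1 \<Longrightarrow> (norm (H z))\<^sup>2 \<le> C * (1 - (norm z)\<^sup>2)"
    and w: "norm w < 1"
  shows "H w = 0"
proof -
  have bd: "norm (H w) \<le> sqrt (C * (1 - r\<^sup>2))" if r: "norm w < r" "r < 1" for r
  proof (rule maximum_modulus_frontier[of H "cball 0 r"])
    have r0: "r > 0" using r norm_ge_zero[of w] by linarith
    show "H holomorphic_on interior (cball 0 r)"
      by (rule holomorphic_on_subset[OF hol]) (use r in auto)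
    show "continuous_on (closure (cball 0 r)) H"
      by (rule continuous_on_subset[OF holomorphic_on_imp_continuous_on[OF hol]]) (use r in auto)
    show "norm (H z) \<le> sqrt (C * (1 - r\<^sup>2))" if "z \<in> frontier (cball 0 r)" for z
      using le[of z] that r r0 by (auto intro!: real_le_rsqrt)
  qed (use r in auto)
  have "\<forall>\<^sub>F r in at_left (1::real). norm (H w) \<le> sqrt (C * (1 - r\<^sup>2))"
    using eventually_at_left_real[OF w] by (rule eventually_mono) (use bd in auto)
  moreover have "((\<lambda>r. sqrt (C * (1 - r\<^sup>2))) \<longlongrightarrow> sqrt (C * (1 - 1\<^sup>2))) (at_left (1::real))"
    by (intro tendsto_intros)
  ultimately have "norm (H w) \<le> sqrt (C * (1 - 1\<^sup>2))"
    using tendsto_lowerbound[OF _ _ trivial_limit_at_left_real] by blast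
  then show ?thesis by simp
qed

section \<open>Slices as complex planes\<close>

text \<open>The slice through \<open>I\<close> is a copy of the complex plane. As a left vector
  space over it the quaternions are \<open>\<complex>\<^sup>2\<close>, and \<open>slice_proj
  I\<close> is a complex linear functional on it, the orthogonal projection to the slice.\<close>

definition slice_emb :: "quat \<Rightarrow> complex \<Rightarrow> quat" where
  "slice_emb I z = slice_point I (Re z) (Im z)"

definition slice_proj :: "quat \<Rightarrow> quat \<Rightarrow> complex" where
  "slice_proj I q = Complex (qre q) (inner I q)"

lemma imag_units_square: "I \<in> imag_units \<Longrightarrow> I * I = -1"
  by (simp add: imag_units_def power2_eq_square)

lemma qre_imag_unit: "I \<in> imag_units \<Longrightarrow> qre I = 0"
  by (simp add: imag_units_iff)

lemma uminus_imag_units [simp]: "- I \<in> imag_units \<longleftrightarrow> I \<in> imag_units"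
  by (simp add: imag_units_def)

lemma slice_emb_sel [simp]:
  "qre (slice_emb I z) = Re z + Im z * qre I" "qi (slice_emb I z) = Im z * qi I"
  "qj (slice_emb I z) = Im z * qj I" "qk (slice_emb I z) = Im z * qk I"
  by (simp_all add: slice_emb_def)

lemma slice_emb_altdef: "slice_emb I z = Re z *\<^sub>R 1 + Im z *\<^sub>R I"
  by (simp add: slice_emb_def slice_point_def of_real_def)

lemma slice_point_eq_emb: "slice_point I x y = slice_emb I (Complex x y)"
  by (simp add: slice_emb_def)

lemma slice_emb_add: "slice_emb I (z + w) = slice_emb I z + slice_emb I w"
  and slice_emb_diff: "slice_emb I (z - w) = slice_emb I z - slice_emb I w"
  and slice_emb_scaleR: "slice_emb I (r *\<^sub>R z) = r *\<^sub>R slice_emb I z"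
  and slice_emb_of_real [simp]: "slice_emb I (of_real r) = of_real r"
  and slice_emb_0 [simp]: "slice_emb I 0 = 0"
  and slice_emb_1 [simp]: "slice_emb I 1 = 1"
  and slice_emb_i [simp]: "slice_emb I \<i> = I"
  and slice_emb_uminus: "slice_emb (- I) z = slice_emb I (cnj z)"
  by (simp_all add: slice_emb_altdef algebra_simps of_real_def)

lemma slice_emb_mult:
  assumes "I \<in> imag_units"
  shows "slice_emb I (z * w) = slice_emb I z * slice_emb I w"
  using imag_units_square[OF assms]
  by (simp add: slice_emb_altdef algebra_simps)

lemma slice_emb_cnj: "I \<in> imag_units \<Longrightarrow> slice_emb I (cnj z) = qcnj (slice_emb I z)"
  by (simp add: quat_eq_iff imag_units_iff)

lemma slice_proj_add: "slice_proj I (p + q) = slice_proj I p + slice_proj I q"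
  and slice_proj_diff: "slice_proj I (p - q) = slice_proj I p - slice_proj I q"
  and slice_proj_scaleR: "slice_proj I (r *\<^sub>R p) = r *\<^sub>R slice_proj I p"
  and slice_proj_0 [simp]: "slice_proj I 0 = 0"
  by (simp_all add: slice_proj_def complex_eq_iff inner_add_right inner_diff_right)

lemma slice_proj_emb_mult:
  assumes "I \<in> imag_units"
  shows "slice_proj I (slice_emb I z * q) = z * slice_proj I q"
proof -
  have I: "qre I = 0" "(qi I)\<^sup>2 + (qj I)\<^sup>2 + (qk I)\<^sup>2 = 1"
    using assms by (simp_all add: imag_units_iff)
  show ?thesis
  proof (rule complex_eqI)
    show "Re (slice_proj I (slice_emb I z * q)) = Re (z * slice_proj I q)"
      using I(1) by (simp add: slice_proj_def inner_quat_def algebra_simps)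
    have "Im (slice_proj I (slice_emb I z * q)) =
        Re z * Im (slice_proj I q) + Im z * qre q * ((qi I)\<^sup>2 + (qj I)\<^sup>2 + (qk I)\<^sup>2)"
      using I(1) by (simp add: slice_proj_def inner_quat_def power2_eq_square algebra_simps)
    then show "Im (slice_proj I (slice_emb I z * q)) = Im (z * slice_proj I q)"
      using I(2) by (simp add: slice_proj_def)
  qed
qed

lemma slice_proj_emb [simp]: "I \<in> imag_units \<Longrightarrow> slice_proj I (slice_emb I z) = z"
  using slice_proj_emb_mult[of I z 1] by (simp add: slice_proj_def complex_eq_iff inner_quat_def qre_imag_unit)

lemma norm_slice_emb:
  assumes "I \<in> imag_units"
  shows "norm (slice_emb I z) = norm z"
proof -
  have "(norm (slice_emb I z))\<^sup>2 = (Re z)\<^sup>2 + (Im z)\<^sup>2 * ((qi I)\<^sup>2 + (qj I)\<^sup>2 + (qk I)\<^sup>2)"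
    unfolding norm_quat_power2 using qre_imag_unit[OF assms]
    by (simp add: power_mult_distrib distrib_left)
  also have "\<dots> = (norm z)\<^sup>2"
    using assms by (simp add: imag_units_iff cmod_power2)
  finally show ?thesis by simp
qed

lemma norm_decompose_slice:
  assumes "I \<in> imag_units"
  shows "(norm q)\<^sup>2 = (norm (slice_proj I q))\<^sup>2 + (norm (q - slice_emb I (slice_proj I q)))\<^sup>2"
proof -
  have "inner 1 I = 0" "inner I 1 = 0" "inner 1 (1 :: quat) = 1" "inner I I = 1"
    using assms by (auto simp: inner_quat_def imag_units_iff power2_eq_square)
  moreover have "qre q = inner 1 q" by (simp add: inner_quat_def)
  ultimately show ?thesis
    unfolding cmod_power2 unfolding power2_norm_eq_inner slice_proj_def slice_emb_altdef
    by (simp add: algebra_simps inner_commute power2_eq_square)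
qed

lemma norm_slice_proj_le:
  assumes "I \<in> imag_units"
  shows "norm (slice_proj I q) \<le> norm q"
proof (rule power2_le_imp_le)
  show "(norm (slice_proj I q))\<^sup>2 \<le> (norm q)\<^sup>2"
    unfolding norm_decompose_slice[OF assms, of q] by (rule le_add_same_cancel1[THEN iffD2]) (rule zero_le_power2)
qed (rule norm_ge_zero)

lemma bounded_linear_slice_proj:
  assumes "I \<in> imag_units"
  shows "bounded_linear (slice_proj I)"
  by (rule bounded_linear_intro[where K = 1])
    (simp_all add: slice_proj_add slice_proj_scaleR norm_slice_proj_le[OF assms])

lemma bounded_linear_slice_emb:
  assumes "I \<in> imag_units"
  shows "bounded_linear (slice_emb I)"
  by (rule bounded_linear_intro[where K = 1])
    (simp_all add: slice_emb_add slice_emb_scaleR norm_slice_emb[OF assms])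

text \<open>The functionals \<open>q \<mapsto> slice_proj I (q * c)\<close> separate points.
  Statements about holomorphic functions carry over to quaternion-valued ones by testing with all
  \<open>c\<close>, and no second imaginary unit orthogonal to \<open>I\<close> has to be
  chosen.\<close>

lemma quat_eqI_slice_proj:
  assumes "\<And>c. slice_proj I (p * c) = slice_proj I (q * c)"
  shows "p = q"
proof -
  have "inner (p - q) (p - q) = Re (slice_proj I (p * qcnj (p - q))) - Re (slice_proj I (q * qcnj (p - q)))"
    by (simp add: slice_proj_def inner_quat_def algebra_simps)
  also have "\<dots> = 0" by (simp add: assms)
  finally show ?thesis by simp
qed

lemma quat_polar:
  obtains J z where "J \<in> imag_units" "q = slice_emb J z" "0 \<le> Im z"
proof -
  define y where "y = sqrt ((qi q)\<^sup>2 + (qj q)\<^sup>2 + (qk q)\<^sup>2)"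
  show thesis
  proof (cases "y = 0")
    case True
    then have "qi q = 0" "qj q = 0" "qk q = 0"
      unfolding y_def by (simp_all add: add_nonneg_eq_0_iff)
    then show thesis
      using that[of "Quat 0 1 0 0" "of_real (qre q)"] by (simp add: imag_units_iff quat_eq_iff of_real_def)
  next
    case False
    have y2: "y\<^sup>2 = (qi q)\<^sup>2 + (qj q)\<^sup>2 + (qk q)\<^sup>2"
      by (simp add: y_def)
    have "y \<ge> 0" by (simp add: y_def)
    define J where "J = Quat 0 (qi q / y) (qj q / y) (qk q / y)"
    have "(qi q / y)\<^sup>2 + (qj q / y)\<^sup>2 + (qk q / y)\<^sup>2 = ((qi q)\<^sup>2 + (qj q)\<^sup>2 + (qk q)\<^sup>2) / y\<^sup>2"
      by (simp add: power_divide add_divide_distrib)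
    also have "\<dots> = 1" unfolding y2[symmetric] using False by simp
    finally have "J \<in> imag_units"
      by (simp add: imag_units_iff J_def)
    moreover have "q = slice_emb J (Complex (qre q) y)"
      using False by (simp add: quat_eq_iff J_def)
    ultimately show thesis using that[of J "Complex (qre q) y"] \<open>y \<ge> 0\<close> by simp
  qed
qed

text \<open>By axial symmetry all slices of the domain have the same trace in the complex
  plane.\<close>

definition slice_trace :: "quat set \<Rightarrow> complex set" where
  "slice_trace \<Omega> = {z. \<forall>I\<in>imag_units. slice_emb I z \<in> \<Omega>}"

lemma imag_units_nonempty: "Quat 0 1 0 0 \<in> imag_units"
  by (simp add: imag_units_iff)

lemma axially_symmetric_slice_domainD:
  assumes "axially_symmetric_slice_domain \<Omega>"
  shows "open \<Omega>" "\<Omega> \<inter> \<real> \<noteq> {}"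
    and "I \<in> imag_units \<Longrightarrow> connected (\<Omega> \<inter> slice_plane I)"
    and "I \<in> imag_units \<Longrightarrow> J \<in> imag_units \<Longrightarrow> slice_emb I z \<in> \<Omega> \<Longrightarrow> slice_emb J z \<in> \<Omega>"
proof -
  note conj = assms[unfolded axially_symmetric_slice_domain_def]
  show "open \<Omega>"
    using conjunct1[OF conj] by (simp add: domain_in_def)
  show "\<Omega> \<inter> \<real> \<noteq> {}"
    by (rule conjunct1[OF conjunct2[OF conj]])
  show "connected (\<Omega> \<inter> slice_plane I)" if "I \<in> imag_units"
    using bspec[OF conjunct1[OF conjunct2[OF conjunct2[OF conj]]] that] by (simp add: domain_in_def)
  show "slice_emb J z \<in> \<Omega>" if "I \<in> imag_units" "J \<in> imag_units" "slice_emb I z \<in> \<Omega>"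
    using conjunct2[OF conjunct2[OF conjunct2[OF conj]], rule_format, OF that(1) _ that(2)] that(3)
    by (simp add: slice_emb_def)
qed

lemma slice_trace_iff:
  assumes "axially_symmetric_slice_domain \<Omega>" "I \<in> imag_units"
  shows "z \<in> slice_trace \<Omega> \<longleftrightarrow> slice_emb I z \<in> \<Omega>"
  using assms(2) axially_symmetric_slice_domainD(4)[OF assms] unfolding slice_trace_def by blast

lemma slice_trace_cnj:
  assumes "z \<in> slice_trace \<Omega>"
  shows "cnj z \<in> slice_trace \<Omega>"
  unfolding slice_trace_def
proof (intro CollectI ballI)
  fix I assume "I \<in> imag_units"
  then have "slice_emb (- I) z \<in> \<Omega>"
    using assms unfolding slice_trace_def by simp
  then show "slice_emb I (cnj z) \<in> \<Omega>" by (simp add: slice_emb_uminus)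
qed

lemma open_slice_trace:
  assumes \<Omega>: "axially_symmetric_slice_domain \<Omega>"
  shows "open (slice_trace \<Omega>)"
proof -
  have "open (slice_emb (Quat 0 1 0 0) -` \<Omega>)"
    by (intro open_vimage axially_symmetric_slice_domainD(1)[OF \<Omega>] linear_continuous_on bounded_linear_slice_emb imag_units_nonempty)
  moreover have "slice_trace \<Omega> = slice_emb (Quat 0 1 0 0) -` \<Omega>"
    using slice_trace_iff[OF \<Omega> imag_units_nonempty] by auto
  ultimately show ?thesis by simp
qed

lemma connected_slice_trace:
  assumes \<Omega>: "axially_symmetric_slice_domain \<Omega>"
  shows "connected (slice_trace \<Omega>)"
proof -
  let ?I = "Quat 0 1 0 0"
  have "connected (slice_proj ?I ` (\<Omega> \<inter> slice_plane ?I))"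
    by (intro connected_continuous_image axially_symmetric_slice_domainD(3)[OF \<Omega>]
        linear_continuous_on bounded_linear_slice_proj imag_units_nonempty)
  moreover have "slice_proj ?I ` (\<Omega> \<inter> slice_plane ?I) = slice_trace \<Omega>"
  proof (intro equalityI subsetI)
    fix z assume "z \<in> slice_proj ?I ` (\<Omega> \<inter> slice_plane ?I)"
    then obtain x y where "z = slice_proj ?I (slice_point ?I x y)" "slice_point ?I x y \<in> \<Omega>"
      unfolding slice_plane_def by blast
    then show "z \<in> slice_trace \<Omega>"
      unfolding slice_point_eq_emb slice_proj_emb[OF imag_units_nonempty]
      by (simp add: slice_trace_iff[OF \<Omega> imag_units_nonempty])
  next
    fix z assume "z \<in> slice_trace \<Omega>"
    then have "slice_emb ?I z \<in> \<Omega>"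
      by (simp add: slice_trace_iff[OF \<Omega> imag_units_nonempty])
    moreover have "slice_emb ?I z \<in> slice_plane ?I"
      unfolding slice_plane_def slice_emb_def by blast
    ultimately show "z \<in> slice_proj ?I ` (\<Omega> \<inter> slice_plane ?I)"
      by (intro image_eqI[of _ _ "slice_emb ?I z"]) (simp_all add: slice_proj_emb[OF imag_units_nonempty])
  qed
  ultimately show ?thesis by simp
qed

lemma slice_trace_meets_reals:
  assumes \<Omega>: "axially_symmetric_slice_domain \<Omega>"
  obtains x where "complex_of_real x \<in> slice_trace \<Omega>"
proof -
  obtain q where "q \<in> \<Omega>" "q \<in> \<real>"
    using axially_symmetric_slice_domainD(2)[OF \<Omega>] by blast
  then obtain x where "of_real x \<in> \<Omega>"
    unfolding Reals_def by blast
  then have "complex_of_real x \<in> slice_trace \<Omega>"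
    by (simp add: slice_trace_def)
  then show thesis by (rule that)
qed

section \<open>Left holomorphic functions on a slice\<close>

text \<open>The real derivative at each point is complex linear for the complex structure on the
  quaternions given by left multiplication with \<open>I\<close>.\<close>

definition left_holomorphic :: "quat \<Rightarrow> complex set \<Rightarrow> (complex \<Rightarrow> quat) \<Rightarrow> bool" where
  "left_holomorphic I D h \<longleftrightarrow>
     (\<forall>z\<in>D. \<exists>d. (h has_derivative (\<lambda>w. slice_emb I w * d)) (at z))"

lemma slice_proj_has_field_derivative:
  assumes I: "I \<in> imag_units" and h: "(h has_derivative (\<lambda>w. slice_emb I w * d)) (at z)"
  shows "((\<lambda>z. slice_proj I (h z * c)) has_field_derivative slice_proj I (d * c)) (at z)"
proof -
  have "slice_proj I (slice_emb I w * d * c) = slice_proj I (d * c) * w" for w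
    unfolding mult.assoc[of _ d] slice_proj_emb_mult[OF I] by (rule mult.commute)
  with bounded_linear.has_derivative[OF bounded_linear_slice_proj[OF I] has_derivative_mult_left[OF h, of c]]
  show ?thesis
    unfolding has_field_derivative_def by simp
qed

lemma left_holomorphic_imp_holomorphic:
  assumes "I \<in> imag_units" "left_holomorphic I D h" "open D"
  shows "(\<lambda>z. slice_proj I (h z * c)) holomorphic_on D"
  unfolding holomorphic_on_open[OF assms(3)]
proof
  fix z assume "z \<in> D"
  then obtain d where "(h has_derivative (\<lambda>w. slice_emb I w * d)) (at z)"
    using assms(2) unfolding left_holomorphic_def by blast
  from slice_proj_has_field_derivative[OF assms(1) this]
  show "\<exists>f'. ((\<lambda>z. slice_proj I (h z * c)) has_field_derivative f') (at z)" by (rule exI)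
qed

text \<open>The four components of \<open>q\<close> are real parts of products \<open>q * c\<close>
  with fixed \<open>c\<close>.\<close>

lemma has_derivative_quat:
  assumes "\<And>c. ((\<lambda>z. qre (h z * c)) has_derivative (\<lambda>w. L c w)) F"
  obtains M where "(h has_derivative M) F"
proof -
  let ?i = "Quat 0 1 0 0" and ?j = "Quat 0 0 1 0" and ?k = "Quat 0 0 0 1"
  have e: "q = qre (q * 1) *\<^sub>R 1 + qre (q * - ?i) *\<^sub>R ?i + qre (q * - ?j) *\<^sub>R ?j + qre (q * - ?k) *\<^sub>R ?k" for q
    by (simp add: quat_eq_iff)
  have "((\<lambda>z. qre (h z * 1) *\<^sub>R 1 + qre (h z * - ?i) *\<^sub>R ?i + qre (h z * - ?j) *\<^sub>R ?j + qre (h z * - ?k) *\<^sub>R ?k)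
    has_derivative (\<lambda>w. L 1 w *\<^sub>R 1 + L (- ?i) w *\<^sub>R ?i + L (- ?j) w *\<^sub>R ?j + L (- ?k) w *\<^sub>R ?k)) F"
    by (intro has_derivative_add has_derivative_scaleR_left assms)
  then show thesis
    unfolding e[of "h _", symmetric] by (rule that)
qed

text \<open>Real differentiability follows componentwise; the derivative \<open>M\<close> is then
  complex linear because every functional \<open>slice_proj I (M w * c)\<close> is, as a function of
  \<open>w\<close>.\<close>

lemma holomorphic_imp_left_holomorphic:
  assumes I: "I \<in> imag_units" and D: "open D"
    and hol: "\<And>c. (\<lambda>z. slice_proj I (h z * c)) holomorphic_on D"
  shows "left_holomorphic I D h"
  unfolding left_holomorphic_def
proof
  fix z assume z: "z \<in> D"
  define \<delta> where "\<delta> c = deriv (\<lambda>z. slice_proj I (h z * c)) z" for c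
  have \<delta>: "((\<lambda>z. slice_proj I (h z * c)) has_derivative (\<lambda>w. w * \<delta> c)) (at z)" for c
    using holomorphic_derivI[OF hol D z, of c] by (simp add: has_field_derivative_def \<delta>_def mult_commute_abs)
  have "((\<lambda>z. qre (h z * c)) has_derivative (\<lambda>w. Re (w * \<delta> c))) (at z)" for c
    using bounded_linear.has_derivative[OF bounded_linear_Re \<delta>[of c]] by (simp add: slice_proj_def)
  then obtain M where M: "(h has_derivative M) (at z)"
    by (rule has_derivative_quat)
  have Mc: "slice_proj I (M w * c) = w * \<delta> c" for w c
  proof -
    have "((\<lambda>z. h z * c) has_derivative (\<lambda>w. M w * c)) (at z)"
      by (rule has_derivative_mult_left[OF M])
    then have "((\<lambda>z. slice_proj I (h z * c)) has_derivative (\<lambda>w. slice_proj I (M w * c))) (at z)"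
      by (rule bounded_linear.has_derivative[OF bounded_linear_slice_proj[OF I]])
    from has_derivative_unique[OF this \<delta>] show ?thesis by (rule fun_cong)
  qed
  have "M w = slice_emb I w * M 1" for w
  proof (rule quat_eqI_slice_proj)
    show "slice_proj I (M w * c) = slice_proj I (slice_emb I w * M 1 * c)" for c
      by (simp add: mult.assoc slice_proj_emb_mult[OF I] Mc)
  qed
  then have "M = (\<lambda>w. slice_emb I w * M 1)" by (rule ext)
  with M have "(h has_derivative (\<lambda>w. slice_emb I w * M 1)) (at z)"
    by (rule has_derivative_eq_rhs)
  then show "\<exists>d. (h has_derivative (\<lambda>w. slice_emb I w * d)) (at z)" ..
qed

lemma continuous_on_left_derivative:
  assumes I: "I \<in> imag_units" and D: "open D"
    and d: "\<And>z. z \<in> D \<Longrightarrow> (h has_derivative (\<lambda>w. slice_emb I w * d z)) (at z)"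
  shows "continuous_on D d"
proof -
  have "left_holomorphic I D h" using d by (auto simp: left_holomorphic_def)
  note hol = left_holomorphic_imp_holomorphic[OF I this D]
  have c: "continuous_on D (\<lambda>z. qre (d z * c))" for c
  proof -
    have "continuous_on D (\<lambda>z. Re (deriv (\<lambda>z. slice_proj I (h z * c)) z))"
      by (intro continuous_on_Re holomorphic_on_imp_continuous_on holomorphic_deriv hol D)
    moreover have "Re (deriv (\<lambda>z. slice_proj I (h z * c)) z) = qre (d z * c)" if "z \<in> D" for z
      using DERIV_imp_deriv[OF slice_proj_has_field_derivative[OF I d[OF that], of c]]
      by (simp add: slice_proj_def)
    ultimately show ?thesis by (rule continuous_on_eq)
  qed
  let ?i = "Quat 0 1 0 0" and ?j = "Quat 0 0 1 0" and ?k = "Quat 0 0 0 1"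
  have e: "q = qre (q * 1) *\<^sub>R 1 + qre (q * - ?i) *\<^sub>R ?i + qre (q * - ?j) *\<^sub>R ?j + qre (q * - ?k) *\<^sub>R ?k" for q
    by (simp add: quat_eq_iff)
  have "continuous_on D (\<lambda>z. qre (d z * 1) *\<^sub>R 1 + qre (d z * - ?i) *\<^sub>R ?i + qre (d z * - ?j) *\<^sub>R ?j + qre (d z * - ?k) *\<^sub>R ?k)"
    by (intro continuous_intros c)
  then show ?thesis unfolding e[of "d _", symmetric] .
qed

lemma left_holomorphic_diff:
  assumes "left_holomorphic I D h" "left_holomorphic I D k"
  shows "left_holomorphic I D (\<lambda>z. h z - k z)"
  unfolding left_holomorphic_def
proof
  fix z assume "z \<in> D"
  with assms obtain d e where "(h has_derivative (\<lambda>w. slice_emb I w * d)) (at z)"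
    "(k has_derivative (\<lambda>w. slice_emb I w * e)) (at z)"
    unfolding left_holomorphic_def by blast
  from has_derivative_diff[OF this]
  show "\<exists>d. ((\<lambda>z. h z - k z) has_derivative (\<lambda>w. slice_emb I w * d)) (at z)"
    by (auto simp flip: right_diff_distrib)
qed

text \<open>The identity principle, for agreement on the real points of the domain.\<close>

lemma left_holomorphic_eqI:
  assumes I: "I \<in> imag_units" and D: "open D" "connected D"
    and h: "left_holomorphic I D h" and k: "left_holomorphic I D k"
    and x: "complex_of_real x \<in> D"
    and eq: "\<And>t. complex_of_real t \<in> D \<Longrightarrow> h (of_real t) = k (of_real t)"
    and z: "z \<in> D"
  shows "h z = k z"
proof -
  have "slice_proj I ((h z - k z) * c) = 0" for c
  proof (rule analytic_continuation[where f = "\<lambda>z. slice_proj I ((h z - k z) * c)" and S = D and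
        U = "D \<inter> \<real>" and \<xi> = "of_real x" and w = z])
    show "(\<lambda>z. slice_proj I ((h z - k z) * c)) holomorphic_on D"
      by (rule left_holomorphic_imp_holomorphic[OF I left_holomorphic_diff[OF h k] D(1)])
    \<comment> \<open>\<open>D\<close> is open, so its real points accumulate at each of them.\<close>
    show "complex_of_real x islimpt D \<inter> \<real>"
      unfolding islimpt_approachable
    proof (intro allI impI)
      fix e :: real assume "e > 0"
      obtain r where r: "r > 0" "ball (of_real x) r \<subseteq> D"
        using D(1) x by (auto simp: open_contains_ball)
      define t where "t = min (e / 2) (r / 2)"
      have t: "0 < t" "t < e" "t < r" using \<open>e > 0\<close> r by (auto simp: t_def)
      have dt: "dist (complex_of_real (x + t)) (of_real x) = t"
        unfolding dist_of_real using t by (simp add: dist_real_def)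
      then have "complex_of_real (x + t) \<in> D \<inter> \<real>"
        using r t by (auto simp: dist_commute)
      moreover have "complex_of_real (x + t) \<noteq> of_real x" using t by (simp del: of_real_add)
      ultimately show "\<exists>x'\<in>D \<inter> \<real>. x' \<noteq> complex_of_real x \<and> dist x' (complex_of_real x) < e"
        using dt t by (intro bexI[of _ "complex_of_real (x + t)"]) (simp_all del: of_real_add)
    qed
    show "slice_proj I ((h z - k z) * c) = 0" if "z \<in> D \<inter> \<real>" for z
      using that eq by (auto simp: Reals_def)
  qed (use D x z in auto)
  then have "h z - k z = 0" by (intro quat_eqI_slice_proj[of I]) simp
  then show ?thesis by simp
qed

text \<open>Removability of the singularity, tested on every functional \<open>q \<mapsto>
  slice_proj I (q * c)\<close>.\<close>

lemma left_holomorphic_difference_quotient: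
  assumes I: "I \<in> imag_units" and D: "open D" and h: "left_holomorphic I D h"
    and d: "(h has_derivative (\<lambda>w. slice_emb I w * d)) (at \<zeta>)"
  shows "left_holomorphic I D
    (\<lambda>z. if z = \<zeta> then d else slice_emb I (inverse (z - \<zeta>)) * (h z - h \<zeta>))"
proof (rule holomorphic_imp_left_holomorphic[OF I D])
  fix c
  have "deriv (\<lambda>z. slice_proj I (h z * c)) \<zeta> = slice_proj I (d * c)"
    by (rule DERIV_imp_deriv[OF slice_proj_has_field_derivative[OF I d]])
  then have "(\<lambda>z. slice_proj I ((if z = \<zeta> then d else slice_emb I (inverse (z - \<zeta>)) * (h z - h \<zeta>)) * c))
    = (\<lambda>z. if z = \<zeta> then deriv (\<lambda>z. slice_proj I (h z * c)) \<zeta>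
        else (slice_proj I (h z * c) - slice_proj I (h \<zeta> * c)) / (z - \<zeta>))"
    by (simp add: fun_eq_iff mult.assoc slice_proj_emb_mult[OF I] left_diff_distrib[where 'a = quat]
        slice_proj_diff divide_inverse mult.commute[where 'a = complex])
  then show "(\<lambda>z. slice_proj I ((if z = \<zeta> then d else slice_emb I (inverse (z - \<zeta>)) * (h z - h \<zeta>)) * c))
    holomorphic_on D"
    using pole_lemma_open[OF left_holomorphic_imp_holomorphic[OF I h D] D] by simp
qed

section \<open>Slice regularity as left holomorphy on every slice\<close>

text \<open>Continuous partial derivatives give a real derivative, and the Cauchy--Riemann equation
  \<open>\<partial>f/\<partial>y = I \<partial>f/\<partial>x\<close> makes it complex
  linear.\<close>

lemma slice_regular_imp_has_derivative:
  assumes \<Omega>: "axially_symmetric_slice_domain \<Omega>" and f: "slice_regular_on \<Omega> f"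
    and I: "I \<in> imag_units" and z: "z \<in> slice_trace \<Omega>"
  shows "((\<lambda>z. f (slice_emb I z)) has_derivative
      (\<lambda>w. slice_emb I w * slice_dx f I (Re z) (Im z))) (at z)"
proof -
  note f_I = f[unfolded slice_regular_on_def, rule_format, OF I]
  define x y where "x = Re z" and "y = Im z"
  have in_iff: "slice_point I u v \<in> \<Omega> \<longleftrightarrow> Complex u v \<in> slice_trace \<Omega>" for u v
    using slice_trace_iff[OF \<Omega> I, of "Complex u v"] by (simp add: slice_point_eq_emb)
  obtain e where e: "e > 0" "ball z e \<subseteq> slice_trace \<Omega>"
    using open_slice_trace[OF \<Omega>] z by (auto simp: open_contains_ball)
  \<comment> \<open>A box around the point inside the domain, since the criterion by partial derivatives
    needs a product with a convex factor.\<close>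
  define X Y where "X = ball x (e / 2)" and "Y = ball y (e / 2)"
  have XY: "slice_point I u v \<in> \<Omega>" if "u \<in> X" "v \<in> Y" for u v
  proof -
    have "dist z (Complex u v) \<le> \<bar>x - u\<bar> + \<bar>y - v\<bar>"
      unfolding dist_norm using cmod_le[of "z - Complex u v"] by (simp add: x_def y_def)
    also have "\<dots> < e" using that by (simp add: X_def Y_def dist_real_def)
    finally show ?thesis using e by (auto simp: in_iff)
  qed
  have xy: "x \<in> X" "y \<in> Y" using e by (auto simp: X_def Y_def)
  have dx: "((\<lambda>t. f (slice_point I t y)) has_derivative (\<lambda>t. t *\<^sub>R slice_dx f I x y)) (at x within X)"
  proof -
    have "(\<lambda>t. f (slice_point I t y)) differentiable at x"
      using f_I XY[OF xy] by blast
    then have "((\<lambda>t. f (slice_point I t y)) has_derivative (\<lambda>t. t *\<^sub>R slice_dx f I x y)) (at x)"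
      unfolding slice_dx_def by (simp add: vector_derivative_works has_vector_derivative_def)
    then show ?thesis by (rule has_derivative_at_withinI)
  qed
  have dy: "((\<lambda>t. f (slice_point I u t)) has_derivative
      blinfun_apply (blinfun_scaleR_left (slice_dy f I u v))) (at v within Y)"
    if "u \<in> X" "v \<in> Y" for u v
  proof -
    have "(\<lambda>t. f (slice_point I u t)) differentiable at v"
      using f_I XY[OF that] by blast
    then have "((\<lambda>t. f (slice_point I u t)) has_derivative (\<lambda>t. t *\<^sub>R slice_dy f I u v)) (at v)"
      unfolding slice_dy_def by (simp add: vector_derivative_works has_vector_derivative_def)
    then show ?thesis by (simp add: has_derivative_at_withinI)
  qed
  have "continuous_on (X \<times> Y) (\<lambda>(u, v). slice_dy f I u v)"
    by (rule continuous_on_subset[where s = "{(u, v). slice_point I u v \<in> \<Omega>}"])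
      (use f_I XY in auto)
  then have "continuous_on (X \<times> Y) (\<lambda>p. blinfun_scaleR_left (case p of (u, v) \<Rightarrow> slice_dy f I u v))"
    by (rule bounded_linear.continuous_on[OF bounded_linear_blinfun_scaleR_left])
  then have cont: "continuous (at (x, y) within X \<times> Y) (\<lambda>(u, v). blinfun_scaleR_left (slice_dy f I u v))"
    using xy by (simp add: continuous_on_eq_continuous_within case_prod_unfold)
  have "((\<lambda>(u, v). f (slice_point I u v)) has_derivative
      (\<lambda>(t, s). t *\<^sub>R slice_dx f I x y + blinfun_scaleR_left (slice_dy f I x y) s)) (at (x, y) within X \<times> Y)"
    by (rule has_derivative_partialsI[OF dx dy cont xy(2)]) (auto simp: Y_def)
  moreover have "open (X \<times> Y)" by (simp add: X_def Y_def open_Times)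
  ultimately have der: "((\<lambda>(u, v). f (slice_point I u v)) has_derivative
      (\<lambda>(t, s). t *\<^sub>R slice_dx f I x y + s *\<^sub>R slice_dy f I x y)) (at (Re z, Im z))"
    using xy by (simp add: at_within_open[of _ "X \<times> Y"] x_def y_def)
  have "((\<lambda>z. (Re z, Im z)) has_derivative (\<lambda>z. (Re z, Im z))) (at z)"
    by (intro has_derivative_Pair bounded_linear_imp_has_derivative bounded_linear_Re bounded_linear_Im)
  from has_derivative_compose[OF this der]
  have der': "((\<lambda>z. f (slice_emb I z)) has_derivative
      (\<lambda>w. Re w *\<^sub>R slice_dx f I x y + Im w *\<^sub>R slice_dy f I x y)) (at z)"
    by (simp add: slice_emb_def)
  \<comment> \<open>The Cauchy--Riemann equation, solved for the derivative in the direction \<open>y\<close>.\<close>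
  have "slice_dx f I x y + I * slice_dy f I x y = 0"
    using f_I XY[OF xy] by simp
  then have "slice_dx f I x y = - (I * slice_dy f I x y)"
    by (simp add: eq_neg_iff_add_eq_0)
  then have "I * slice_dx f I x y = - (I * I) * slice_dy f I x y"
    by (simp add: mult.assoc)
  then have "I * slice_dx f I x y = slice_dy f I x y"
    by (simp add: imag_units_square[OF I])
  then have "(\<lambda>w. Re w *\<^sub>R slice_dx f I x y + Im w *\<^sub>R slice_dy f I x y) =
      (\<lambda>w. slice_emb I w * slice_dx f I x y)"
    by (simp add: fun_eq_iff slice_emb_altdef distrib_right)
  with der' show ?thesis by (simp add: x_def y_def)
qed

lemma slice_regular_imp_left_holomorphic:
  assumes "axially_symmetric_slice_domain \<Omega>" "slice_regular_on \<Omega> f" "I \<in> imag_units"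
  shows "left_holomorphic I (slice_trace \<Omega>) (\<lambda>z. f (slice_emb I z))"
  unfolding left_holomorphic_def using slice_regular_imp_has_derivative[OF assms] by blast

lemma left_holomorphic_imp_slice_regular:
  assumes \<Omega>: "axially_symmetric_slice_domain \<Omega>"
    and f: "\<And>I. I \<in> imag_units \<Longrightarrow> left_holomorphic I (slice_trace \<Omega>) (\<lambda>z. f (slice_emb I z))"
  shows "slice_regular_on \<Omega> f"
  unfolding slice_regular_on_def
proof
  fix I assume I: "I \<in> imag_units"
  have in_iff: "slice_point I u v \<in> \<Omega> \<longleftrightarrow> Complex u v \<in> slice_trace \<Omega>" for u v
    using slice_trace_iff[OF \<Omega> I, of "Complex u v"] by (simp add: slice_point_eq_emb)
  obtain d where d: "\<And>z. z \<in> slice_trace \<Omega> \<Longrightarrow>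
      ((\<lambda>z. f (slice_emb I z)) has_derivative (\<lambda>w. slice_emb I w * d z)) (at z)"
    using f[OF I] unfolding left_holomorphic_def by metis
  have cont: "continuous_on (slice_trace \<Omega>) d"
    by (rule continuous_on_left_derivative[OF I open_slice_trace[OF \<Omega>] d])
  have dx: "((\<lambda>t. f (slice_point I t y)) has_vector_derivative d (Complex x y)) (at x)"
    and dy: "((\<lambda>t. f (slice_point I x t)) has_vector_derivative I * d (Complex x y)) (at y)"
    if "slice_point I x y \<in> \<Omega>" for x y
  proof -
    have D: "((\<lambda>z. f (slice_emb I z)) has_derivative (\<lambda>w. slice_emb I w * d (Complex x y))) (at (Complex x y))"
      using d that by (simp add: in_iff)
    have "((\<lambda>t. Complex t y) has_derivative (\<lambda>t. of_real t)) (at x)"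
      unfolding Complex_eq by (auto intro!: derivative_eq_intros)
    from has_derivative_compose[OF this D]
    show "((\<lambda>t. f (slice_point I t y)) has_vector_derivative d (Complex x y)) (at x)"
      by (simp add: has_vector_derivative_def slice_point_eq_emb scaleR_conv_of_real)
    have "((\<lambda>t. Complex x t) has_derivative (\<lambda>t. t *\<^sub>R \<i>)) (at y)"
      unfolding Complex_eq by (auto intro!: derivative_eq_intros simp: scaleR_conv_of_real mult.commute)
    from has_derivative_compose[OF this D]
    show "((\<lambda>t. f (slice_point I x t)) has_vector_derivative I * d (Complex x y)) (at y)"
      by (simp add: has_vector_derivative_def slice_point_eq_emb slice_emb_scaleR)
  qed
  have dxy: "slice_dx f I x y = d (Complex x y)" "slice_dy f I x y = I * d (Complex x y)"
    if "slice_point I x y \<in> \<Omega>" for x y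
    unfolding slice_dx_def slice_dy_def
    using dx[OF that] dy[OF that] by (auto intro: vector_derivative_at)
  let ?D = "{(x, y). slice_point I x y \<in> \<Omega>}"
  have "continuous_on ?D (\<lambda>p. Complex (fst p) (snd p))"
    unfolding Complex_eq by (intro continuous_intros)
  then have cont': "continuous_on ?D (\<lambda>p. d (Complex (fst p) (snd p)))"
    by (rule continuous_on_compose2[OF cont]) (auto simp: in_iff)
  have "continuous_on ?D (\<lambda>(x, y). slice_dx f I x y)"
    by (rule continuous_on_eq[OF cont']) (auto simp: dxy)
  moreover have "continuous_on ?D (\<lambda>(x, y). slice_dy f I x y)"
    by (rule continuous_on_eq[OF continuous_on_mult_left[OF cont', of I]]) (auto simp: dxy)
  moreover have "(1 / 2) *\<^sub>R (slice_dx f I x y + I * slice_dy f I x y) = 0"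
    if "slice_point I x y \<in> \<Omega>" for x y
    using imag_units_square[OF I] by (simp add: dxy[OF that] flip: mult.assoc)
  moreover have "(\<lambda>t. f (slice_point I t y)) differentiable at x \<and>
      (\<lambda>t. f (slice_point I x t)) differentiable at y" if "slice_point I x y \<in> \<Omega>" for x y
    using dx[OF that] dy[OF that] by (auto intro: differentiableI_vector)
  ultimately show "(\<forall>x y. slice_point I x y \<in> \<Omega> \<longrightarrow>
      (\<lambda>t. f (slice_point I t y)) differentiable at x \<and>
      (\<lambda>t. f (slice_point I x t)) differentiable at y) \<and>
    continuous_on ?D (\<lambda>(x, y). slice_dx f I x y) \<and>
    continuous_on ?D (\<lambda>(x, y). slice_dy f I x y) \<and>
    (\<forall>x y. slice_point I x y \<in> \<Omega> \<longrightarrow>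
      (1 / 2) *\<^sub>R (slice_dx f I x y + I * slice_dy f I x y) = 0)"
    by blast
qed

lemma slice_deriv_eq_slice_dx:
  assumes f: "slice_regular_on \<Omega> f" and I: "I \<in> imag_units" and z: "slice_emb I z \<in> \<Omega>"
  shows "slice_deriv f (slice_emb I z) = slice_dx f I (Re z) (Im z)"
proof -
  have "slice_dx f I (Re z) (Im z) + I * slice_dy f I (Re z) (Im z) = 0"
    using f I z unfolding slice_regular_on_def slice_emb_def by force
  then have "slice_dx f I (Re z) (Im z) - I * slice_dy f I (Re z) (Im z) = 2 *\<^sub>R slice_dx f I (Re z) (Im z)"
    by (simp add: add_eq_0_iff scaleR_2)
  then show ?thesis
    unfolding slice_emb_def slice_deriv_slice_point[OF f I z[unfolded slice_emb_def]] by simp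
qed

section \<open>The representation formula\<close>

text \<open>The right-hand side of the representation formula, which recovers a slice regular
  function from its restriction \<open>h\<close> to the slice through \<open>I\<close>. It has the
  form \<open>\<alpha> z + J * \<beta> z\<close> with \<open>\<alpha>\<close> even and
  \<open>\<beta>\<close> odd under conjugation of \<open>z\<close>.\<close>

definition slice_extension :: "quat \<Rightarrow> (complex \<Rightarrow> quat) \<Rightarrow> quat \<Rightarrow> complex \<Rightarrow> quat" where
  "slice_extension I h J z = (1/2) *\<^sub>R ((1 - J * I) * h z + (1 + J * I) * h (cnj z))"

lemma slice_extension_uminus_cnj: "slice_extension I h (- J) (cnj z) = slice_extension I h J z"
  by (simp add: slice_extension_def add.commute)

lemma slice_extension_same:
  assumes "I \<in> imag_units"
  shows "slice_extension I h I z = h z"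
  by (simp add: slice_extension_def imag_units_square[OF assms] flip: scaleR_2)

lemma slice_extension_real:
  "slice_extension I h J (of_real t) = h (of_real t)"
  by (simp add: slice_extension_def flip: distrib_right)

text \<open>Left multiplication by \<open>1 - J I\<close> and by \<open>1 + J I\<close> carries the
  complex structure \<open>I\<close>, respectively \<open>- I\<close>, into \<open>J\<close>. This
  is the reason why the extension of a left holomorphic function is left holomorphic on every
  slice.\<close>

lemma slice_emb_intertwine:
  assumes "I \<in> imag_units" "J \<in> imag_units"
  shows "slice_emb J z * (1 - J * I) = (1 - J * I) * slice_emb I z"
    and "slice_emb J z * (1 + J * I) = (1 + J * I) * slice_emb I (cnj z)"
proof -
  have "J * (J * I) = - I" "J * I * I = - J"
    using imag_units_square[OF assms(1)] imag_units_square[OF assms(2)]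
    by (simp_all flip: mult.assoc) (simp add: mult.assoc)
  then show "slice_emb J z * (1 - J * I) = (1 - J * I) * slice_emb I z"
    "slice_emb J z * (1 + J * I) = (1 + J * I) * slice_emb I (cnj z)"
    by (simp_all add: slice_emb_altdef algebra_simps)
qed

lemma left_holomorphic_slice_extension:
  assumes I: "I \<in> imag_units" and J: "J \<in> imag_units" and D: "\<And>z. z \<in> D \<Longrightarrow> cnj z \<in> D"
    and h: "left_holomorphic I D h"
  shows "left_holomorphic J D (slice_extension I h J)"
  unfolding left_holomorphic_def
proof
  fix z assume "z \<in> D"
  then obtain d e where d: "(h has_derivative (\<lambda>w. slice_emb I w * d)) (at z)"
    and e: "(h has_derivative (\<lambda>w. slice_emb I w * e)) (at (cnj z))"
    using h D unfolding left_holomorphic_def by meson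
  have "(cnj has_derivative cnj) (at z)"
    by (rule bounded_linear_imp_has_derivative[OF bounded_linear_cnj])
  from has_derivative_compose[OF this e]
  have "((\<lambda>z. (1/2) *\<^sub>R ((1 - J * I) * h z + (1 + J * I) * h (cnj z))) has_derivative
     (\<lambda>w. (1/2) *\<^sub>R ((1 - J * I) * (slice_emb I w * d) + (1 + J * I) * (slice_emb I (cnj w) * e)))) (at z)"
    by (intro has_derivative_scaleR_right has_derivative_add has_derivative_mult_right d)
  moreover have "(\<lambda>w. (1/2) *\<^sub>R ((1 - J * I) * (slice_emb I w * d) + (1 + J * I) * (slice_emb I (cnj w) * e)))
     = (\<lambda>w. slice_emb J w * ((1/2) *\<^sub>R ((1 - J * I) * d + (1 + J * I) * e)))"
    unfolding mult.assoc[symmetric] slice_emb_intertwine[OF I J, symmetric]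
    unfolding mult.assoc unfolding mult_scaleR_right distrib_left ..
  ultimately have "(slice_extension I h J has_derivative
      (\<lambda>w. slice_emb J w * ((1/2) *\<^sub>R ((1 - J * I) * d + (1 + J * I) * e)))) (at z)"
    unfolding slice_extension_def[abs_def] by (rule has_derivative_eq_rhs)
  then show "\<exists>d. (slice_extension I h J has_derivative (\<lambda>w. slice_emb J w * d)) (at z)" ..
qed

text \<open>Both sides are left holomorphic for \<open>J\<close> and agree at the real points, so
  the identity principle applies.\<close>

lemma representation_formula:
  assumes \<Omega>: "axially_symmetric_slice_domain \<Omega>" and f: "slice_regular_on \<Omega> f"
    and I: "I \<in> imag_units" and J: "J \<in> imag_units" and z: "z \<in> slice_trace \<Omega>"
  shows "f (slice_emb J z) = slice_extension I (\<lambda>z. f (slice_emb I z)) J z"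
proof -
  obtain x where x: "complex_of_real x \<in> slice_trace \<Omega>"
    by (rule slice_trace_meets_reals[OF \<Omega>])
  show ?thesis
  proof (rule left_holomorphic_eqI[OF J open_slice_trace[OF \<Omega>] connected_slice_trace[OF \<Omega>]
        slice_regular_imp_left_holomorphic[OF \<Omega> f J] _ x _ z])
    show "left_holomorphic J (slice_trace \<Omega>) (slice_extension I (\<lambda>z. f (slice_emb I z)) J)"
      by (intro left_holomorphic_slice_extension I J slice_trace_cnj
          slice_regular_imp_left_holomorphic[OF \<Omega> f I])
  qed (simp add: slice_extension_real)
qed

text \<open>A quaternion determines the pair \<open>(J, z)\<close> only up to \<open>(- J, cnj
  z)\<close>, and on the real axis \<open>J\<close> is arbitrary; the extension formula gives the
  same value for all these choices, so any choice defines the function.\<close>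

lemma slice_regular_extension:
  assumes \<Omega>: "axially_symmetric_slice_domain \<Omega>" and I: "I \<in> imag_units"
    and h: "left_holomorphic I (slice_trace \<Omega>) h"
  shows "\<exists>g. slice_regular_on \<Omega> g \<and> (\<forall>q. q \<notin> \<Omega> \<longrightarrow> g q = 0) \<and>
    (\<forall>J\<in>imag_units. \<forall>z\<in>slice_trace \<Omega>. g (slice_emb J z) = slice_extension I h J z)"
proof -
  define P where "P q p \<longleftrightarrow> fst p \<in> imag_units \<and> q = slice_emb (fst p) (snd p)" for q and p :: "quat \<times> complex"
  define g where "g q = (if q \<in> \<Omega> then let p = SOME p. P q p in slice_extension I h (fst p) (snd p) else 0)" for q
  have g: "g (slice_emb J z) = slice_extension I h J z" if J: "J \<in> imag_units" and z: "z \<in> slice_trace \<Omega>" for J z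
  proof -
    define p where "p = (SOME p. P (slice_emb J z) p)"
    have "P (slice_emb J z) (J, z)" using J by (simp add: P_def)
    then have "P (slice_emb J z) p" unfolding p_def by (rule someI)
    then have p: "fst p \<in> imag_units" "slice_emb J z = slice_emb (fst p) (snd p)"
      by (auto simp: P_def)
    have "slice_extension I h (fst p) (snd p) = slice_extension I h J z"
      using slice_point_eqD[OF J p(1) p(2)[unfolded slice_emb_def]]
    proof (elim conjE disjE)
      assume "Re z = Re (snd p)" "Im z = 0" "Im (snd p) = 0"
      then have "z = of_real (Re z)" "snd p = of_real (Re z)" by (simp_all add: complex_eq_iff)
      then show ?thesis by (metis slice_extension_real)
    next
      assume "Re z = Re (snd p)" "Im z = Im (snd p)" "J = fst p"
      then have "z = snd p" "J = fst p" by (simp_all add: complex_eq_iff)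
      then show ?thesis by simp
    next
      assume "Re z = Re (snd p)" "Im z = - Im (snd p)" "J = - fst p"
      then have "z = cnj (snd p)" "J = - fst p" by (simp_all add: complex_eq_iff)
      then show ?thesis by (simp only: slice_extension_uminus_cnj)
    qed
    moreover have "slice_emb J z \<in> \<Omega>" using z slice_trace_iff[OF \<Omega> J] by simp
    ultimately show ?thesis by (simp add: g_def p_def Let_def)
  qed
  show ?thesis
  proof (intro exI[of _ g] conjI ballI allI impI)
    show "slice_regular_on \<Omega> g"
    proof (rule left_holomorphic_imp_slice_regular[OF \<Omega>])
      fix J assume J: "J \<in> imag_units"
      have "left_holomorphic J (slice_trace \<Omega>) (slice_extension I h J)"
        by (intro left_holomorphic_slice_extension I J h slice_trace_cnj)
      then show "left_holomorphic J (slice_trace \<Omega>) (\<lambda>z. g (slice_emb J z))"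
        unfolding left_holomorphic_def
        using has_derivative_transform_within_open[OF _ open_slice_trace[OF \<Omega>]] g[OF J] by metis
    qed
    show "g q = 0" if "q \<notin> \<Omega>" for q using that by (simp add: g_def)
  qed (rule g)
qed

section \<open>The quotient operator on the slice of its point\<close>

lemma slice_extension_cong:
  assumes "h z = k z" "h (cnj z) = k (cnj z)"
  shows "slice_extension I h J z = slice_extension I k J z"
  using assms by (simp add: slice_extension_def)

lemma slice_extension_diff_const:
  "slice_extension I (\<lambda>z. h z - c) J z = slice_extension I h J z - c"
proof -
  have "(1 - J * I) * c + (1 + J * I) * c = 2 *\<^sub>R c"
    by (simp add: algebra_simps scaleR_2)
  then have "(1/2) *\<^sub>R ((1 - J * I) * c + (1 + J * I) * c) = c" by simp
  moreover have "slice_extension I (\<lambda>z. h z - c) J z =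
      slice_extension I h J z - (1/2) *\<^sub>R ((1 - J * I) * c + (1 + J * I) * c)"
    unfolding slice_extension_def scaleR_diff_right[symmetric] by (simp add: algebra_simps)
  ultimately show ?thesis by simp
qed

lemma slice_extension_emb:
  assumes "I \<in> imag_units" "J \<in> imag_units"
  shows "slice_extension I (slice_emb I) J z = slice_emb J z"
  unfolding slice_extension_def slice_emb_intertwine[OF assms, symmetric] distrib_left[symmetric]
  by (simp flip: scaleR_2)

lemma slice_emb_commute: "I \<in> imag_units \<Longrightarrow> slice_emb I z * slice_emb I w = slice_emb I w * slice_emb I z"
  by (simp add: mult.commute flip: slice_emb_mult)

lemma slice_emb_eq_0_iff: "I \<in> imag_units \<Longrightarrow> slice_emb I z = 0 \<longleftrightarrow> z = 0"
  using norm_slice_emb[of I z] by auto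

lemma conjugate_imag_unit:
  assumes "J \<in> imag_units" "q \<noteq> 0"
  shows "inverse q * J * q \<in> imag_units"
    and "slice_emb (inverse q * J * q) z = inverse q * slice_emb J z * q"
proof -
  have "inverse q * J * q * (inverse q * J * q) = inverse q * (J * (q * inverse q) * J) * q"
    by (simp only: mult.assoc)
  also have "\<dots> = -1" using assms imag_units_square[OF assms(1)] by simp
  finally show "inverse q * J * q \<in> imag_units"
    by (simp add: imag_units_def power2_eq_square)
  show "slice_emb (inverse q * J * q) z = inverse q * slice_emb J z * q"
    using assms(2) by (simp add: slice_emb_altdef algebra_simps)
qed

text \<open>Conjugation by an element of a slice fixes the slice pointwise, so there the regular
  product with \<open>q - \<xi>\<close> is the pointwise one.\<close>

lemma linear_star_same_slice:
  assumes I: "I \<in> imag_units" and \<zeta>: "\<zeta> \<noteq> 0"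
  shows "linear_star (slice_emb I \<zeta>) g (slice_emb I z) = slice_emb I (z - \<zeta>) * g (slice_emb I z)"
proof -
  have "inverse (slice_emb I \<zeta>) * slice_emb I z * slice_emb I \<zeta> = slice_emb I z"
    using \<zeta> slice_emb_eq_0_iff[OF I, of \<zeta>]
    by (simp add: mult.assoc slice_emb_commute[OF I, of z]) (simp flip: mult.assoc)
  then show ?thesis by (simp add: linear_star_def slice_emb_diff left_diff_distrib)
qed

text \<open>The regular product with \<open>q - \<xi>\<close> is again given by the representation
  formula, because \<open>\<xi>\<close> turns the unit \<open>\<xi>\<^sup>-\<^sup>1 J \<xi>\<close>
  into \<open>J\<close> when it moves to its right. Hence an identity between such products needs to
  be checked only on the slice of \<open>\<xi>\<close>, where the product is pointwise.\<close>

lemma linear_star_representation: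
  assumes I: "I \<in> imag_units" and J: "J \<in> imag_units" and \<zeta>: "\<zeta> \<noteq> 0"
    and g: "\<And>J. J \<in> imag_units \<Longrightarrow> g (slice_emb J z) = slice_extension I (\<lambda>z. g (slice_emb I z)) J z"
  shows "linear_star (slice_emb I \<zeta>) g (slice_emb J z) =
    slice_extension I (\<lambda>z. slice_emb I (z - \<zeta>) * g (slice_emb I z)) J z"
proof -
  define \<xi> K where "\<xi> = slice_emb I \<zeta>" and "K = inverse \<xi> * J * \<xi>"
  define a b where "a = g (slice_emb I z)" and "b = g (slice_emb I (cnj z))"
  have \<xi>: "\<xi> \<noteq> 0" using \<zeta> slice_emb_eq_0_iff[OF I] by (simp add: \<xi>_def)
  have K: "K \<in> imag_units" "slice_emb K z = inverse \<xi> * slice_emb J z * \<xi>"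
    using conjugate_imag_unit[OF J \<xi>] by (simp_all add: K_def)
  have "\<xi> * K = J * \<xi>" using \<xi> by (simp add: K_def flip: mult.assoc)
  moreover have "\<xi> * I = I * \<xi>"
    using slice_emb_commute[OF I, of \<zeta> \<i>] by (simp add: \<xi>_def)
  ultimately have "\<xi> * (K * I) = J * I * \<xi>" by (metis mult.assoc)
  then have xi: "\<xi> * ((1 - K * I) * a) = (1 - J * I) * (\<xi> * a)" "\<xi> * ((1 + K * I) * b) = (1 + J * I) * (\<xi> * b)"
    by (simp_all add: distrib_left distrib_right left_diff_distrib right_diff_distrib flip: mult.assoc)
  have K_part: "\<xi> * g (slice_emb K z) = (1/2) *\<^sub>R ((1 - J * I) * (\<xi> * a) + (1 + J * I) * (\<xi> * b))"
    unfolding g[OF K(1)] slice_extension_def a_def[symmetric] b_def[symmetric] xi[symmetric]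
    by (simp add: distrib_left)
  have J_part: "slice_emb J z * g (slice_emb J z) =
      (1/2) *\<^sub>R ((1 - J * I) * (slice_emb I z * a) + (1 + J * I) * (slice_emb I (cnj z) * b))"
    unfolding g[OF J] slice_extension_def a_def[symmetric] b_def[symmetric]
      mult.assoc[symmetric] slice_emb_intertwine[OF I J, symmetric]
    unfolding mult.assoc mult_scaleR_right distrib_left[of "slice_emb J z" "(1 - J * I) * a"] ..
  show ?thesis
    unfolding linear_star_def \<xi>_def[symmetric] K(2)[symmetric] J_part K_part
    unfolding slice_extension_def a_def[symmetric] b_def[symmetric] slice_emb_diff \<xi>_def[symmetric]
      scaleR_diff_right[symmetric]
    by (simp add: algebra_simps)
qed

text \<open>The value at \<open>\<zeta>\<close> is the one that removes the singularity.\<close>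

definition slice_quotient :: "(quat \<Rightarrow> quat) \<Rightarrow> quat \<Rightarrow> complex \<Rightarrow> complex \<Rightarrow> quat" where
  "slice_quotient f I \<zeta> z =
     (if z = \<zeta> then slice_deriv f (slice_emb I \<zeta>)
      else slice_emb I (inverse (z - \<zeta>)) * (f (slice_emb I z) - f (slice_emb I \<zeta>)))"

context
  fixes \<Omega> :: "quat set" and f :: "quat \<Rightarrow> quat" and I :: quat and \<zeta> :: complex
  assumes \<Omega>: "axially_symmetric_slice_domain \<Omega>" and f: "slice_regular_on \<Omega> f"
    and I: "I \<in> imag_units" and \<zeta>: "\<zeta> \<in> slice_trace \<Omega>" "\<zeta> \<noteq> 0"
begin

lemma left_holomorphic_slice_quotient:
  "left_holomorphic I (slice_trace \<Omega>) (slice_quotient f I \<zeta>)"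
proof -
  have "slice_deriv f (slice_emb I \<zeta>) = slice_dx f I (Re \<zeta>) (Im \<zeta>)"
    using \<zeta>(1) by (intro slice_deriv_eq_slice_dx[OF f I]) (simp add: slice_trace_iff[OF \<Omega> I])
  then have "((\<lambda>z. f (slice_emb I z)) has_derivative (\<lambda>w. slice_emb I w * slice_deriv f (slice_emb I \<zeta>))) (at \<zeta>)"
    using slice_regular_imp_has_derivative[OF \<Omega> f I \<zeta>(1)] by simp
  from left_holomorphic_difference_quotient[OF I open_slice_trace[OF \<Omega>]
      slice_regular_imp_left_holomorphic[OF \<Omega> f I] this]
  show ?thesis unfolding slice_quotient_def[abs_def] .
qed

text \<open>Off \<open>\<zeta>\<close> the defining equation can be divided by \<open>z -
  \<zeta>\<close>; at \<open>\<zeta>\<close> both sides are continuous.\<close>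

lemma quotient_on_slice:
  assumes g: "slice_regular_on \<Omega> g"
    and eq: "\<And>q. q \<in> \<Omega> \<Longrightarrow> f q - f (slice_emb I \<zeta>) = linear_star (slice_emb I \<zeta>) g q"
    and z: "z \<in> slice_trace \<Omega>"
  shows "g (slice_emb I z) = slice_quotient f I \<zeta> z"
proof -
  have off: "g (slice_emb I z) = slice_quotient f I \<zeta> z" if "z \<in> slice_trace \<Omega>" "z \<noteq> \<zeta>" for z
  proof -
    have "slice_emb I (inverse (z - \<zeta>)) * (f (slice_emb I z) - f (slice_emb I \<zeta>)) =
        slice_emb I (inverse (z - \<zeta>)) * (slice_emb I (z - \<zeta>) * g (slice_emb I z))"
      using eq[of "slice_emb I z"] that(1) slice_trace_iff[OF \<Omega> I] linear_star_same_slice[OF I \<zeta>(2)]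
      by simp
    also have "\<dots> = slice_emb I (inverse (z - \<zeta>) * (z - \<zeta>)) * g (slice_emb I z)"
      by (simp add: slice_emb_mult[OF I] mult.assoc)
    also have "\<dots> = g (slice_emb I z)" using that(2) by simp
    finally show ?thesis using that(2) by (simp add: slice_quotient_def)
  qed
  have cont: "(h \<longlongrightarrow> h \<zeta>) (at \<zeta>)" if h: "left_holomorphic I (slice_trace \<Omega>) h" for h
  proof -
    obtain d where "(h has_derivative (\<lambda>w. slice_emb I w * d)) (at \<zeta>)"
      using h \<zeta>(1) unfolding left_holomorphic_def by blast
    from has_derivative_continuous[OF this] show ?thesis by (simp add: isCont_def)
  qed
  have "\<forall>\<^sub>F z in at \<zeta>. slice_quotient f I \<zeta> z = g (slice_emb I z)"
    using eventually_at_in_open[OF open_slice_trace[OF \<Omega>] \<zeta>(1)]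
    by (rule eventually_mono) (use off in auto)
  from Lim_transform_eventually[OF cont[OF left_holomorphic_slice_quotient] this]
  have "g (slice_emb I \<zeta>) = slice_quotient f I \<zeta> \<zeta>"
    by (rule tendsto_unique[OF at_neq_bot cont[OF slice_regular_imp_left_holomorphic[OF \<Omega> g I]]])
  with off z show ?thesis by metis
qed

text \<open>Existence: extend the difference quotient from the slice of \<open>\<zeta>\<close>; the
  defining equation holds on that slice, hence everywhere by the representation formula. Uniqueness:
  the values on that slice are forced, and they determine a slice regular function on the
  domain.\<close>

lemma ex1_regular_quotient:
  "\<exists>!g. slice_regular_on \<Omega> g \<and>
    (\<forall>q\<in>\<Omega>. f q - f (slice_emb I \<zeta>) = linear_star (slice_emb I \<zeta>) g q) \<and> (\<forall>q. q \<notin> \<Omega> \<longrightarrow> g q = 0)"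
    (is "\<exists>!g. ?P g")
proof -
  obtain g where g: "slice_regular_on \<Omega> g" "\<And>q. q \<notin> \<Omega> \<Longrightarrow> g q = 0"
    and gJ: "\<And>J z. J \<in> imag_units \<Longrightarrow> z \<in> slice_trace \<Omega> \<Longrightarrow>
      g (slice_emb J z) = slice_extension I (slice_quotient f I \<zeta>) J z"
    using slice_regular_extension[OF \<Omega> I left_holomorphic_slice_quotient] by blast
  have gI: "g (slice_emb I z) = slice_quotient f I \<zeta> z" if "z \<in> slice_trace \<Omega>" for z
    unfolding gJ[OF I that] by (rule slice_extension_same[OF I])
  have "f q - f (slice_emb I \<zeta>) = linear_star (slice_emb I \<zeta>) g q" if "q \<in> \<Omega>" for q
  proof -
    obtain J z where J: "J \<in> imag_units" and q: "q = slice_emb J z" by (rule quat_polar)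
    have z: "z \<in> slice_trace \<Omega>" using that slice_trace_iff[OF \<Omega> J] by (simp add: q)
    have *: "f (slice_emb I z) - f (slice_emb I \<zeta>) = slice_emb I (z - \<zeta>) * g (slice_emb I z)"
      if "z \<in> slice_trace \<Omega>" for z
    proof (cases "z = \<zeta>")
      case False
      then have "slice_emb I (z - \<zeta>) * slice_emb I (inverse (z - \<zeta>)) = 1"
        by (simp flip: slice_emb_mult[OF I])
      then show ?thesis
        using False by (simp add: gI[OF that] slice_quotient_def flip: mult.assoc)
    qed simp
    have "f q - f (slice_emb I \<zeta>) = slice_extension I (\<lambda>z. f (slice_emb I z) - f (slice_emb I \<zeta>)) J z"
      unfolding q representation_formula[OF \<Omega> f I J z] slice_extension_diff_const ..
    also have "\<dots> = slice_extension I (\<lambda>z. slice_emb I (z - \<zeta>) * g (slice_emb I z)) J z"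
      by (intro slice_extension_cong * z slice_trace_cnj)
    also have "\<dots> = linear_star (slice_emb I \<zeta>) g q"
      unfolding q by (rule linear_star_representation[OF I J \<zeta>(2), symmetric])
        (rule representation_formula[OF \<Omega> g(1) I _ z])
    finally show ?thesis .
  qed
  with g have P: "?P g" by blast
  moreover have "g' = g" if "?P g'" for g'
  proof (rule ext)
    fix q
    have g': "slice_regular_on \<Omega> g'" using that by blast
    show "g' q = g q"
    proof (cases "q \<in> \<Omega>")
      case True
      obtain J z where J: "J \<in> imag_units" and q: "q = slice_emb J z" by (rule quat_polar)
      have z: "z \<in> slice_trace \<Omega>" using True slice_trace_iff[OF \<Omega> J] by (simp add: q)
      have same: "g' (slice_emb I z) = g (slice_emb I z)" if "z \<in> slice_trace \<Omega>" for z
        using quotient_on_slice[OF g' _ that] \<open>?P g'\<close> gI[OF that] by simp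
      then show ?thesis
        unfolding q representation_formula[OF \<Omega> g' I J z] representation_formula[OF \<Omega> g(1) I J z]
        by (intro slice_extension_cong same z slice_trace_cnj)
    qed (use that g in auto)
  qed
  ultimately show ?thesis by (rule ex1I)
qed

lemma regular_quotient_props:
  shows "slice_regular_on \<Omega> (regular_quotient \<Omega> (slice_emb I \<zeta>) f)"
    and "z \<in> slice_trace \<Omega> \<Longrightarrow>
      regular_quotient \<Omega> (slice_emb I \<zeta>) f (slice_emb I z) = slice_quotient f I \<zeta> z"
proof -
  note * = theI'[OF ex1_regular_quotient, folded regular_quotient_def]
  from * show "slice_regular_on \<Omega> (regular_quotient \<Omega> (slice_emb I \<zeta>) f)" by blast
  from quotient_on_slice[OF this] * show "z \<in> slice_trace \<Omega> \<Longrightarrow>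
      regular_quotient \<Omega> (slice_emb I \<zeta>) f (slice_emb I z) = slice_quotient f I \<zeta> z" by blast
qed

end

lemma slice_emb_proj:
  assumes "I \<in> imag_units"
  shows "slice_emb I (slice_proj I q) = (1/2) *\<^sub>R (q - I * q * I)"
proof -
  have I: "qre I = 0" "(qi I)\<^sup>2 + (qj I)\<^sup>2 + (qk I)\<^sup>2 = 1"
    using assms by (simp_all add: imag_units_iff)
  define a b c where "a = qi I" and "b = qj I" and "c = qk I"
  have abc: "a * a = 1 - b * b - c * c"
    using I(2) by (simp add: a_def b_def c_def power2_eq_square)
  have e: "a * (a * x) = x - b * (b * x) - c * (c * x)" for x
    using arg_cong[OF abc, of "\<lambda>t. t * x"] by (simp add: algebra_simps)
  show ?thesis
    unfolding quat_eq_iff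
    using I(1) by (simp add: slice_proj_def inner_quat_def flip: a_def b_def c_def)
      (simp add: algebra_simps e abc)
qed

text \<open>Taking the commutator with \<open>\<xi>\<close> kills the part of its argument inside
  the slice and multiplies the orthogonal part from the left by \<open>\<xi> - qcnj \<xi>\<close>,
  which cancels the denominator of the quotient. What is subtracted from \<open>d\<close> is
  therefore the part of \<open>d - slice_emb I b\<close> orthogonal to the slice, which is that of
  \<open>d\<close>.\<close>

lemma second_quotient_commutator:
  assumes I: "I \<in> imag_units" and y: "Im \<zeta> \<noteq> 0"
  shows "d - commutator (slice_emb I \<zeta>) (slice_emb I (inverse (\<zeta> - cnj \<zeta>)) * (d - slice_emb I b)) =
    slice_emb I (slice_proj I d)"
proof -
  define k where "k = slice_emb I (inverse (\<zeta> - cnj \<zeta>)) * (d - slice_emb I b)"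
  have II: "I * I = -1" by (rule imag_units_square[OF I])
  have cb: "slice_emb I b * I = I * slice_emb I b"
    using slice_emb_commute[OF I, of b \<i>] by simp
  have "inverse (\<zeta> - cnj \<zeta>) = (- 1 / (2 * Im \<zeta>)) *\<^sub>R \<i>"
    using y by (simp add: complex_diff_cnj scaleR_conv_of_real field_simps)
  then have k: "k = (- 1 / (2 * Im \<zeta>)) *\<^sub>R (I * (d - slice_emb I b))"
    unfolding k_def by (simp only: slice_emb_scaleR slice_emb_i mult_scaleR_left)
  have "commutator (slice_emb I \<zeta>) k = Im \<zeta> *\<^sub>R (I * k - k * I)"
    by (simp add: commutator_def slice_emb_altdef algebra_simps)
  also have "\<dots> = (- 1 / 2) *\<^sub>R (I * (I * (d - slice_emb I b)) - I * (d - slice_emb I b) * I)"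
    using y unfolding k by (simp add: scaleR_diff_right)
  also have "I * (I * (d - slice_emb I b)) - I * (d - slice_emb I b) * I = - d - I * d * I"
    by (simp add: left_diff_distrib right_diff_distrib mult.assoc cb)
      (simp add: II flip: mult.assoc)
  finally have "d - commutator (slice_emb I \<zeta>) k = d - (- 1 / 2) *\<^sub>R (- d - I * d * I)" by simp
  also have "\<dots> = (1/2) *\<^sub>R (d - I * d * I)"
    by (simp add: quat_eq_iff field_simps)
  finally show ?thesis unfolding slice_emb_proj[OF I] k_def .
qed

section \<open>Boundary values\<close>

lemma inner_left_mult: "inner p (q * r) = inner (p * qcnj r) (q :: quat)"
  by (simp add: inner_quat_def algebra_simps)

text \<open>Expanding the square shows that \<open>inner (\<xi> * qcnj \<beta>) J\<close> is largest
  at \<open>J = I\<close>, where \<open>\<xi> = slice_emb I \<zeta>\<close>. A linear form on the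
  sphere of imaginary units is largest in the direction of its own vector, so the imaginary part of
  \<open>\<xi> * qcnj \<beta>\<close> is a multiple of \<open>I\<close>, and \<open>\<beta>\<close>
  lies in the slice.\<close>

lemma slice_coefficient_if_extremal:
  assumes I: "I \<in> imag_units" and \<zeta>: "norm \<zeta> = 1"
    and le: "\<And>J. J \<in> imag_units \<Longrightarrow> norm (slice_emb I \<zeta> + (J - I) * \<beta>) \<le> 1"
  obtains b where "\<beta> = slice_emb I b"
proof -
  define \<xi> w where "\<xi> = slice_emb I \<zeta>" and "w = \<xi> * qcnj \<beta>"
  have n\<xi>: "norm \<xi> = 1" using \<zeta> by (simp add: \<xi>_def norm_slice_emb[OF I])
  have wJ: "inner w J \<le> inner w I" if J: "J \<in> imag_units" for J
  proof -
    have "(norm (\<xi> + (J - I) * \<beta>))\<^sup>2 \<le> 1"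
      using le[OF J] by (simp add: \<xi>_def power_le_one)
    moreover have "(norm (\<xi> + (J - I) * \<beta>))\<^sup>2 = 1 + 2 * inner \<xi> ((J - I) * \<beta>) + (norm ((J - I) * \<beta>))\<^sup>2"
      using n\<xi> power2_norm_eq_inner[of \<xi>]
      by (simp add: power2_norm_eq_inner[of "_ + _"] inner_add_left inner_add_right inner_commute
          power2_norm_eq_inner[of "_ * _"])
    ultimately have "2 * inner \<xi> ((J - I) * \<beta>) + (norm ((J - I) * \<beta>))\<^sup>2 \<le> 0" by linarith
    then have "inner \<xi> ((J - I) * \<beta>) \<le> 0"
      using zero_le_power2[of "norm ((J - I) * \<beta>)"] by linarith
    then show ?thesis unfolding inner_left_mult w_def[symmetric] by (simp add: inner_diff_right)
  qed
  obtain J z where J: "J \<in> imag_units" and w: "w = slice_emb J z" and z: "0 \<le> Im z"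
    by (rule quat_polar)
  have unit: "inner K K = 1" "inner 1 K = 0" if "K \<in> imag_units" for K
    using that by (simp_all add: inner_quat_def imag_units_iff power2_eq_square)
  have "Im z \<le> Im z * inner J I"
    using wJ[OF J] unit[OF J] unit[OF I] by (simp add: w slice_emb_altdef inner_add_left)
  then have "Im z = 0 \<or> 1 \<le> inner J I"
    using z by (cases "Im z = 0") (auto simp: mult_le_cancel_left1)
  then have wI: "w = slice_emb I z"
  proof
    assume "1 \<le> inner J I"
    then have "inner (J - I) (J - I) \<le> 0"
      using unit[OF J] unit[OF I] by (simp add: inner_diff_left inner_diff_right inner_commute)
    then have "inner (J - I) (J - I) = 0" using inner_ge_zero by (rule antisym)
    then have "J = I" by simp
    then show ?thesis by (simp add: w)
  qed (simp add: w slice_emb_altdef)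
  have "qcnj \<xi> * \<xi> = 1" using n\<xi> by (simp add: qcnj_mult_self)
  then have "qcnj \<beta> = qcnj \<xi> * w" by (simp add: w_def flip: mult.assoc)
  also have "\<dots> = slice_emb I (cnj \<zeta> * z)"
    by (simp add: \<xi>_def wI slice_emb_mult[OF I] slice_emb_cnj[OF I])
  finally have "qcnj (qcnj \<beta>) = qcnj (slice_emb I (cnj \<zeta> * z))" by simp
  moreover have "qcnj (qcnj \<beta>) = \<beta>" by (simp add: quat_eq_iff)
  ultimately have "\<beta> = slice_emb I (cnj (cnj \<zeta> * z))" by (simp only: slice_emb_cnj[OF I])
  then show thesis by (rule that)
qed

context
  fixes \<Omega> :: "quat set" and f :: "quat \<Rightarrow> quat" and \<zeta> :: complex
  assumes \<Omega>: "axially_symmetric_slice_domain \<Omega>" and f: "slice_regular_on \<Omega> f"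
    and ball: "ball 0 1 \<subseteq> \<Omega>" and self: "f ` ball 0 1 \<subseteq> ball 0 1"
    and \<zeta>: "\<zeta> \<in> slice_trace \<Omega>" "norm \<zeta> = 1"
begin

lemma disc_subset_slice_trace: "ball 0 1 \<subseteq> slice_trace \<Omega>"
  using ball by (auto simp: slice_trace_def norm_slice_emb)

lemma norm_self_map_less:
  assumes "J \<in> imag_units" "norm z < 1"
  shows "norm (f (slice_emb J z)) < 1"
  using self assms norm_slice_emb[OF assms(1), of z] by (auto simp: image_subset_iff)

lemma norm_boundary_value_le:
  assumes J: "J \<in> imag_units"
  shows "norm (f (slice_emb J \<zeta>)) \<le> 1"
proof -
  have "isCont (\<lambda>z. f (slice_emb J z)) \<zeta>"
    using slice_regular_imp_has_derivative[OF \<Omega> f J \<zeta>(1)] by (rule has_derivative_continuous)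
  then have "isCont (\<lambda>z. f (slice_emb J z)) (of_real 1 * \<zeta>)" by simp
  then have "isCont (\<lambda>t::real. f (slice_emb J (of_real t * \<zeta>))) 1"
    by (intro isCont_o2[where g = "\<lambda>z. f (slice_emb J z)" and f = "\<lambda>t. of_real t * \<zeta>"]) auto
  then have "((\<lambda>t::real. f (slice_emb J (of_real t * \<zeta>))) \<longlongrightarrow> f (slice_emb J (of_real 1 * \<zeta>))) (at_left 1)"
    using filterlim_at_split isCont_def by blast
  then have lim: "((\<lambda>t::real. norm (f (slice_emb J (of_real t * \<zeta>)))) \<longlongrightarrow> norm (f (slice_emb J \<zeta>))) (at_left 1)"
    using tendsto_norm by fastforce
  have "\<forall>\<^sub>F t in at_left (1::real). norm (f (slice_emb J (of_real t * \<zeta>))) \<le> 1"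
    using eventually_at_left_real[OF zero_less_one]
  proof (rule eventually_mono)
    fix t :: real assume "t \<in> {0<..<1}"
    then show "norm (f (slice_emb J (of_real t * \<zeta>))) \<le> 1"
      using norm_self_map_less[OF J, of "of_real t * \<zeta>"] \<zeta>(2) by (simp add: norm_mult)
  qed
  then show ?thesis
    by (intro tendsto_upperbound[OF lim _ trivial_limit_at_left_real])
qed

text \<open>On the sphere of \<open>\<xi> = slice_emb I \<zeta>\<close> the function is the affine
  function \<open>J \<mapsto> \<xi> + (J - I) \<beta>\<close>, whose modulus is at most
  \<open>1\<close> and equals \<open>1\<close> at \<open>J = I\<close>.\<close>

lemma boundary_value_at_conjugate:
  assumes I: "I \<in> imag_units" and fixed: "f (slice_emb I \<zeta>) = slice_emb I \<zeta>"
  obtains b where "f (slice_emb I (cnj \<zeta>)) = slice_emb I b"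
proof -
  define \<xi> v where "\<xi> = slice_emb I \<zeta>" and "v = f (slice_emb I (cnj \<zeta>))"
  define \<beta> where "\<beta> = (- 1 / 2) *\<^sub>R (I * (\<xi> - v))"
  have II: "I * I = -1" by (rule imag_units_square[OF I])
  have "norm (\<xi> + (J - I) * \<beta>) \<le> 1" if J: "J \<in> imag_units" for J
  proof -
    have "(J - I) * \<beta> = (- 1 / 2) *\<^sub>R ((J * I - I * I) * (\<xi> - v))"
      by (simp add: \<beta>_def left_diff_distrib mult.assoc)
    then have "(J - I) * \<beta> = (- 1 / 2) *\<^sub>R ((1 + J * I) * (\<xi> - v))"
      by (simp add: II add.commute)
    moreover have "\<xi> = (1/2) *\<^sub>R (2 *\<^sub>R \<xi>)" by simp
    ultimately have "\<xi> + (J - I) * \<beta> = (1/2) *\<^sub>R (2 *\<^sub>R \<xi> - (1 + J * I) * (\<xi> - v))"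
      by (simp add: scaleR_diff_right)
    also have "2 *\<^sub>R \<xi> - (1 + J * I) * (\<xi> - v) = (1 - J * I) * \<xi> + (1 + J * I) * v"
      by (simp add: algebra_simps scaleR_2)
    also have "(1/2) *\<^sub>R \<dots> = f (slice_emb J \<zeta>)"
      unfolding representation_formula[OF \<Omega> f I J \<zeta>(1)] slice_extension_def fixed \<xi>_def v_def ..
    finally show ?thesis using norm_boundary_value_le[OF J] by simp
  qed
  then obtain b where "\<beta> = slice_emb I b"
    unfolding \<xi>_def by (rule slice_coefficient_if_extremal[OF I \<zeta>(2)])
  moreover have "v = \<xi> - 2 *\<^sub>R (I * \<beta>)"
    by (simp add: \<beta>_def II flip: mult.assoc)
  ultimately have "v = slice_emb I (\<zeta> - 2 *\<^sub>R (\<i> * b))"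
    by (simp add: slice_emb_diff slice_emb_scaleR slice_emb_mult[OF I] \<xi>_def)
  then show thesis unfolding v_def by (rule that)
qed

text \<open>If the component of \<open>f\<close> inside the slice is the identity, then on the slice
  \<open>|f|\<^sup>2 < 1\<close> leaves less than \<open>1 - |z|\<^sup>2\<close> for the orthogonal
  component. The holomorphic functions that test this component then vanish by the maximum
  principle.\<close>

lemma identity_if_slice_component_identity:
  assumes I: "I \<in> imag_units"
    and id: "\<And>z. norm z < 1 \<Longrightarrow> slice_proj I (f (slice_emb I z)) = z"
    and q: "norm q < 1"
  shows "f q = q"
proof -
  have fI: "f (slice_emb I z) = slice_emb I z" if z: "norm z < 1" for z
  proof (rule quat_eqI_slice_proj[of I])
    fix c
    have "slice_proj I (f (slice_emb I z) * c) - slice_proj I (slice_emb I z * c) = 0"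
    proof (rule eq_0_if_norm_square_le[where
          H = "\<lambda>z. slice_proj I (f (slice_emb I z) * c) - slice_proj I (slice_emb I z * c)"])
      show "(\<lambda>z. slice_proj I (f (slice_emb I z) * c) - slice_proj I (slice_emb I z * c)) holomorphic_on ball 0 1"
        unfolding slice_proj_emb_mult[OF I]
        by (intro holomorphic_intros holomorphic_on_subset[OF left_holomorphic_imp_holomorphic[OF I
              slice_regular_imp_left_holomorphic[OF \<Omega> f I] open_slice_trace[OF \<Omega>]]]
            disc_subset_slice_trace)
      show "(norm (slice_proj I (f (slice_emb I z) * c) - slice_proj I (slice_emb I z * c)))\<^sup>2
          \<le> (norm c)\<^sup>2 * (1 - (norm z)\<^sup>2)" if z: "norm z < 1" for z
      proof -
        have "slice_proj I (f (slice_emb I z) * c) - slice_proj I (slice_emb I z * c) =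
            slice_proj I ((f (slice_emb I z) - slice_emb I z) * c)"
          by (simp add: left_diff_distrib slice_proj_diff)
        also have "(norm \<dots>)\<^sup>2 \<le> (norm ((f (slice_emb I z) - slice_emb I z) * c))\<^sup>2"
          by (intro power_mono norm_slice_proj_le[OF I]) simp
        also have "\<dots> = (norm c)\<^sup>2 * (norm (f (slice_emb I z) - slice_emb I z))\<^sup>2"
          by (simp add: norm_mult power_mult_distrib)
        also have "(norm (f (slice_emb I z) - slice_emb I z))\<^sup>2 = (norm (f (slice_emb I z)))\<^sup>2 - (norm z)\<^sup>2"
          using norm_decompose_slice[OF I, of "f (slice_emb I z)"] id[OF z] by simp
        also have "(norm c)\<^sup>2 * \<dots> \<le> (norm c)\<^sup>2 * (1 - (norm z)\<^sup>2)"
          using norm_self_map_less[OF I z] by (intro mult_left_mono) (auto simp: power_le_one)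
        finally show ?thesis .
      qed
    qed (fact z)
    then show "slice_proj I (f (slice_emb I z) * c) = slice_proj I (slice_emb I z * c)" by simp
  qed
  obtain J z where J: "J \<in> imag_units" and qz: "q = slice_emb J z" by (rule quat_polar)
  have z: "norm z < 1" using q by (simp add: qz norm_slice_emb[OF J])
  then have "z \<in> slice_trace \<Omega>" using disc_subset_slice_trace by auto
  then have "f q = slice_extension I (\<lambda>z. f (slice_emb I z)) J z"
    unfolding qz by (rule representation_formula[OF \<Omega> f I J])
  also have "\<dots> = slice_extension I (slice_emb I) J z"
    using z by (intro slice_extension_cong fI) auto
  finally show ?thesis unfolding qz slice_extension_emb[OF I J] .
qed

text \<open>The component of \<open>f\<close> inside the slice is a holomorphic self-map of the disc
  fixing \<open>0\<close> and \<open>\<zeta>\<close>, so the boundary Schwarz lemma applies to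
  it.\<close>

lemma slice_component_of_boundary_derivative:
  assumes I: "I \<in> imag_units" and fixed: "f (slice_emb I \<zeta>) = slice_emb I \<zeta>" and f0: "f 0 = 0"
    and nid: "\<not> (\<forall>q\<in>ball 0 1. f q = q)"
  shows "Im (slice_proj I (slice_deriv f (slice_emb I \<zeta>))) = 0 \<and>
    1 < Re (slice_proj I (slice_deriv f (slice_emb I \<zeta>)))"
proof -
  define F where "F z = slice_proj I (f (slice_emb I z))" for z
  show ?thesis
  proof (rule boundary_Schwarz[of F \<zeta>])
    have "F holomorphic_on slice_trace \<Omega>"
      using left_holomorphic_imp_holomorphic[OF I slice_regular_imp_left_holomorphic[OF \<Omega> f I]
          open_slice_trace[OF \<Omega>], of 1]
      by (simp add: F_def[abs_def])
    then show "F holomorphic_on ball 0 1"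
      by (rule holomorphic_on_subset) (rule disc_subset_slice_trace)
    show "F 0 = 0" by (simp add: F_def f0)
    show "norm (F z) < 1" if "norm z < 1" for z
      using norm_slice_proj_le[OF I] norm_self_map_less[OF I that] unfolding F_def
      by (rule order.strict_trans1)
    have "slice_deriv f (slice_emb I \<zeta>) = slice_dx f I (Re \<zeta>) (Im \<zeta>)"
      using \<zeta>(1) by (intro slice_deriv_eq_slice_dx[OF f I]) (simp add: slice_trace_iff[OF \<Omega> I])
    then show "(F has_field_derivative slice_proj I (slice_deriv f (slice_emb I \<zeta>))) (at \<zeta>)"
      using slice_proj_has_field_derivative[OF I slice_regular_imp_has_derivative[OF \<Omega> f I \<zeta>(1)], of 1]
      by (simp add: F_def[abs_def])
    show "F \<zeta> = \<zeta>" by (simp add: F_def fixed I)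
    show "\<not> (\<forall>z. norm z < 1 \<longrightarrow> F z = z)"
    proof
      assume "\<forall>z. norm z < 1 \<longrightarrow> F z = z"
      then have "f q = q" if "norm q < 1" for q
        using that by (intro identity_if_slice_component_identity[OF I]) (simp_all add: F_def)
      with nid show False by simp
    qed
  qed (fact \<zeta>)
qed

end

theorem corollary1:
  fixes f :: "quat \<Rightarrow> quat" and \<xi> :: quat and \<Omega> :: "quat set"
  assumes "\<xi> \<in> frontier (ball 0 1)"
    and "axially_symmetric_slice_domain \<Omega>"
    and "ball 0 1 \<union> conj_class \<xi> \<subseteq> \<Omega>"
    and "slice_regular_on \<Omega> f"
    and "f ` ball 0 1 \<subseteq> ball 0 1"
    and "f 0 = 0"
    and "f \<xi> = \<xi>"
    and "\<not> (\<forall>q\<in>ball 0 1. f q = q)"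
  shows "\<exists>r::real.
    slice_deriv f \<xi> -
      commutator \<xi> (regular_quotient \<Omega> (qcnj \<xi>) (regular_quotient \<Omega> \<xi> f) \<xi>) = of_real r
    \<and> r > 1"
proof -
  note \<Omega> = assms(2) and f = assms(4)
  obtain I \<zeta> where I: "I \<in> imag_units" and \<xi>: "\<xi> = slice_emb I \<zeta>" by (rule quat_polar)
  have "norm \<xi> = 1" using assms(1) by simp
  then have n\<zeta>: "norm \<zeta> = 1" by (simp add: \<xi> norm_slice_emb[OF I])
  then have \<zeta>0: "\<zeta> \<noteq> 0" "cnj \<zeta> \<noteq> 0" by auto
  have "\<xi> \<in> conj_class \<xi>" unfolding conj_class_def by (intro CollectI exI[of _ 1]) simp
  then have "slice_emb I \<zeta> \<in> \<Omega>" using assms(3) by (auto simp: \<xi>)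
  then have \<zeta>: "\<zeta> \<in> slice_trace \<Omega>" by (simp add: slice_trace_iff[OF \<Omega> I])
  then have c\<zeta>: "cnj \<zeta> \<in> slice_trace \<Omega>" by (rule slice_trace_cnj)
  have ball: "ball 0 1 \<subseteq> \<Omega>" using assms(3) by blast
  note deriv = slice_component_of_boundary_derivative[OF \<Omega> f ball assms(5) \<zeta> n\<zeta> _ _ assms(6,8)]
  define d where "d = slice_deriv f \<xi>"
  define k where "k = regular_quotient \<Omega> (qcnj \<xi>) (regular_quotient \<Omega> \<xi> f) \<xi>"
  show ?thesis
  proof (cases "Im \<zeta> = 0")
    case True
    then have \<zeta>r: "\<zeta> = of_real (Re \<zeta>)" by (simp add: complex_eq_iff)
    then have \<xi>r: "\<xi> = of_real (Re \<zeta>)" unfolding \<xi> by (metis slice_emb_of_real)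
    \<comment> \<open>A real \<open>\<xi>\<close> lies in every slice, and the component of \<open>d\<close> in each of them is real.\<close>
    have dJ: "inner J d = 0 \<and> 1 < qre d" if J: "J \<in> imag_units" for J
    proof -
      have J\<xi>: "slice_emb J \<zeta> = \<xi>" unfolding \<xi>r by (subst \<zeta>r) (rule slice_emb_of_real)
      from deriv[OF J, unfolded J\<xi>, OF assms(7)]
      show ?thesis by (simp add: d_def slice_proj_def)
    qed
    have "qi d = 0" "qj d = 0" "qk d = 0"
      using dJ[of "Quat 0 1 0 0"] dJ[of "Quat 0 0 1 0"] dJ[of "Quat 0 0 0 1"]
      by (simp_all add: imag_units_iff inner_quat_def)
    then have "d = of_real (qre d)" by (simp add: quat_eq_iff of_real_def)
    moreover have "commutator \<xi> k = 0"
      unfolding \<xi>r commutator_def by (simp add: quat_eq_iff of_real_def)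
    ultimately show ?thesis
      using dJ[OF I] by (intro exI[of _ "qre d"]) (simp add: d_def k_def)
  next
    case False
    then have ne: "\<zeta> \<noteq> cnj \<zeta>" by (simp add: complex_eq_iff)
    define g where "g = regular_quotient \<Omega> \<xi> f"
    have g: "slice_regular_on \<Omega> g" "\<And>z. z \<in> slice_trace \<Omega> \<Longrightarrow> g (slice_emb I z) = slice_quotient f I \<zeta> z"
      using regular_quotient_props[OF \<Omega> f I \<zeta> \<zeta>0(1)] by (simp_all add: g_def \<xi>)
    obtain b where b: "f (slice_emb I (cnj \<zeta>)) = slice_emb I b"
      using boundary_value_at_conjugate[OF \<Omega> f ball assms(5) \<zeta> n\<zeta> I] assms(7) \<xi> by metis
    have "k = regular_quotient \<Omega> (slice_emb I (cnj \<zeta>)) g (slice_emb I \<zeta>)"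
      by (simp add: k_def g_def \<xi> slice_emb_cnj[OF I])
    also have "\<dots> = slice_quotient g I (cnj \<zeta>) \<zeta>"
      by (rule regular_quotient_props(2)[OF \<Omega> g(1) I c\<zeta> \<zeta>0(2) \<zeta>])
    also have "\<dots> = slice_emb I (inverse (\<zeta> - cnj \<zeta>)) * (g (slice_emb I \<zeta>) - g (slice_emb I (cnj \<zeta>)))"
      using ne by (simp add: slice_quotient_def)
    also have "g (slice_emb I \<zeta>) = d"
      by (simp add: g(2)[OF \<zeta>] slice_quotient_def d_def \<xi>)
    also have "g (slice_emb I (cnj \<zeta>)) = slice_emb I (inverse (cnj \<zeta> - \<zeta>) * (b - \<zeta>))"
      using ne assms(7) by (simp add: g(2)[OF c\<zeta>] slice_quotient_def b \<xi> slice_emb_mult[OF I] slice_emb_diff)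
    finally have "d - commutator \<xi> k = slice_emb I (slice_proj I d)"
      unfolding \<xi> by (simp only: second_quotient_commutator[OF I False])
    moreover have "Im (slice_proj I d) = 0 \<and> 1 < Re (slice_proj I d)"
      using deriv[OF I] assms(7) by (simp add: d_def \<xi>)
    moreover from this have "slice_proj I d = of_real (Re (slice_proj I d))"
      by (simp add: complex_eq_iff)
    ultimately have "d - commutator \<xi> k = of_real (Re (slice_proj I d)) \<and> 1 < Re (slice_proj I d)"
      by (metis slice_emb_of_real)
    then show ?thesis unfolding d_def k_def by blast
  qed
qed

end
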